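(* Let the plane bipartite graphs $G_R$, $G_E$, $G_V$ be the constituents of a trinity with point sets $R$, $E$, $V$. Fix an outer white triangle $t_0$, adjacent to the points $r_0\in R$, $e_0\in E$, $v_0\in V$ (the roots), and form the enhanced adjacency matrix $M_{e\to v}$. Then for the hypergraph $\mathscr H=(V,E)$ and its hypertree polytope $Q_{\mathscr H}$ we have $Q_{\mathscr H}=\det M_{e\to v}$ in the following sense: $\det M_{e\to v}$ is a sum of monomials in the indeterminates $e\in E$; either each monomial has coefficient $+1$ or each has coefficient $-1$; and the set of exponent vectors (in $\mathbf Z^E$) of these monomials is exactly the set $Q_{\mathscr H}\cap\mathbf Z^E$ of hypertrees of $\mathscr H$.
   Context: A trinity is a triangulation of the sphere $S^2$ (multiple edges allowed) together with a three-coloring of the $0$-simplices (points) by red, emerald and violet, such that points joined by a $1$-simplex (edge) have different colors. $R$, $E$, $V$ are the sets of red, emerald, violet points. Each edge gets the color not occurring among its ends. The red graph $G_R$ is the plane bipartite graph with color classes $E$ and $V$ and the red edges; $G_E$ has color classes $R,V$ and the emerald edges; $G_V$ has color classes $R,E$ and the violet edges. The hypergraph $\mathscr H=(V,E)$ has vertex set $V$ and hyperedges indexed by $E$, each $e\in E$ being the set of its neighbors in $G_R$. A hypertree in $\mathscr H$ is a function $f\colon E\to\mathbf N=\{0,1,2,\ldots\}$ such that some spanning tree of $G_R$ has degree $f(e)+1$ at each $e\in E$. The hypertree polytope $Q_{\mathscr H}\subset\mathbf R^E$ is the convex hull of the hypertrees, and its integer points are exactly the hypertrees. Each triangle has exactly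 one point of each color (a triangle and its points are called adjacent). Triangles are colored black or white according to the cyclic order of the colors around them relative to the orientation of the sphere; triangles sharing an edge have opposite colors. By Euler's formula the total number of points is the number of white triangles plus $2$, so for a fixed outer white triangle $t_0$ with points $r_0,e_0,v_0$ (the roots), the number of non-root points equals the number of non-outer white triangles. Let $M$ be the square adjacency matrix with rows indexed by the non-root points (of all three colors) and columns indexed by the non-outer white triangles, with entry $1$ if the point is adjacent to the triangle and $0$ otherwise. The enhanced adjacency matrix $M_{e\to v}$ is obtained from $M$ as follows: regard the elements of $E$ (including $e_0$) as indeterminates; whenever a non-outer white triangle $t_i$ is adjacent to the emerald point $e_j$ and to the non-root violet point $v_k$, replace the entry $1$ in row $v_k$ and column $t_i$ by the indeterminate $e_j$. All other entries are unchanged. The determinant is taken in $\mathbf Z[E]$, the polynomial ring in these indeterminates. *)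

theory Defs
  imports
    "HOL-Analysis.Analysis"
    "HOL-Library.Poly_Mapping"
    "Jordan_Normal_Form.Determinant"
begin

section \<open>Triangulations of the sphere\<close>

text \<open>
  A triangulation with multiple edges allowed is a finite 2-dimensional cell complex, given by
  its points \<^typ>\<open>'p\<close>, edges \<^typ>\<open>'a\<close> and triangles \<^typ>\<open>'t\<close> together with the two end points
  of each edge and the three sides of each triangle. Edges are objects in their own right, so
  several edges can have the same ends, and several triangles the same corners.
\<close>

definition corners :: "('a \<Rightarrow> 'p set) \<Rightarrow> ('t \<Rightarrow> 'a set) \<Rightarrow> 't \<Rightarrow> 'p set" where
  "corners ends sides t = (\<Union>a\<in>sides t. ends a)"

definition joined :: "('a \<Rightarrow> 'p set) \<Rightarrow> 'a set \<Rightarrow> ('p \<times> 'p) set" where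
  "joined ends F = {(p, q). \<exists>a\<in>F. ends a = {p, q}}"

text \<open>
  The axioms \<open>two_triangles\<close>, \<open>used\<close> and \<open>link\<close> say that the complex is a closed surface: each edge
  lies on exactly two triangles, and the triangles around a point form a single cycle (each of
  them has two sides at the point, so for this it suffices that they are connected through such
  sides). Among the connected closed surfaces, the sphere is the one of Euler characteristic 2.

  The set \<open>ori t\<close> is the positive cyclic order of the corners of \<open>t\<close>, written as the set of pairs
  of consecutive corners. By \<open>coherent\<close>, the two triangles at an edge induce opposite directions
  on it, so \<open>ori\<close> is one of the two orientations of the sphere.
\<close>

locale oriented_sphere_triangulation =
  fixes ends :: "'a::finite \<Rightarrow> 'p::finite set"
    and sides :: "'t::finite \<Rightarrow> 'a set"
    and ori :: "'t \<Rightarrow> ('p \<times> 'p) set"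
  assumes ends: "card (ends a) = 2"
    and sides: "card (sides t) = 3" "inj_on ends (sides t)"
    and corners: "card (corners ends sides t) = 3"
    and two_triangles: "card {t. a \<in> sides t} = 2"
    and used: "\<exists>t. p \<in> corners ends sides t"
    and link: "\<lbrakk>p \<in> corners ends sides s; p \<in> corners ends sides t\<rbrakk>
      \<Longrightarrow> (s, t) \<in> {(s, t). \<exists>a \<in> sides s \<inter> sides t. p \<in> ends a}\<^sup>*"
    and connected: "(p, q) \<in> (joined ends UNIV)\<^sup>*"
    and euler: "int CARD('p) - int CARD('a) + int CARD('t) = 2"
    and cyclic: "\<exists>x y z. corners ends sides t = {x, y, z} \<and> ori t = {(x, y), (y, z), (z, x)}"
    and coherent: "\<lbrakk>s \<noteq> t; a \<in> sides s; a \<in> sides t; ends a = {p, q}\<rbrakk>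
      \<Longrightarrow> (p, q) \<in> ori s \<longleftrightarrow> (p, q) \<notin> ori t"

section \<open>Trinities\<close>

datatype colour = Red | Emerald | Violet

text \<open>
  The colour classes \<open>R\<close>, \<open>E\<close>, \<open>V\<close> are the types \<^typ>\<open>'r\<close>, \<^typ>\<open>'e\<close>, \<^typ>\<open>'v\<close>. In particular \<open>\<real>\<^sup>E\<close>
  is \<^typ>\<open>real ^ 'e\<close>.
\<close>

datatype ('r, 'e, 'v) point = RedPt 'r | EmeraldPt 'e | VioletPt 'v

instance point :: (finite, finite, finite) finite
proof
  have "p \<in> range RedPt \<union> range EmeraldPt \<union> range VioletPt"
    for p :: "('a::finite, 'b::finite, 'c::finite) point"
    by (cases p) auto
  then have "(UNIV :: ('a, 'b, 'c) point set) \<subseteq> range RedPt \<union> range EmeraldPt \<union> range VioletPt"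
    by blast
  then show "finite (UNIV :: ('a, 'b, 'c) point set)"
    by (rule finite_subset) simp
qed

fun colour_of :: "('r, 'e, 'v) point \<Rightarrow> colour" where
  "colour_of (RedPt r) = Red"
| "colour_of (EmeraldPt e) = Emerald"
| "colour_of (VioletPt v) = Violet"

locale trinity = oriented_sphere_triangulation ends sides ori
  for ends :: "'a::finite \<Rightarrow> ('r::finite, 'e::finite, 'v::finite) point set"
    and sides :: "'t::finite \<Rightarrow> 'a set"
    and ori :: "'t \<Rightarrow> (('r, 'e, 'v) point \<times> ('r, 'e, 'v) point) set" +
  assumes proper: "inj_on colour_of (ends a)"

text \<open>
  White triangles are those whose corners appear in the positive cyclic order red, emerald, violet.
  The opposite convention amounts to the opposite choice of \<open>ori\<close>.
\<close>

definition white :: "('t \<Rightarrow> (('r, 'e, 'v) point \<times> ('r, 'e, 'v) point) set) \<Rightarrow> 't set" where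
  "white ori = {t. \<exists>r e. (RedPt r, EmeraldPt e) \<in> ori t}"

definition edge_colour :: "('a \<Rightarrow> ('r, 'e, 'v) point set) \<Rightarrow> 'a \<Rightarrow> colour" where
  "edge_colour ends a = (THE c. c \<notin> colour_of ` ends a)"

text \<open>Points and edges of the constituent graph of colour \<open>c\<close>, e.g. \<open>G\<^sub>R\<close> for \<open>c = Red\<close>.\<close>

definition graph_points :: "colour \<Rightarrow> ('r, 'e, 'v) point set" where
  "graph_points c = {p. colour_of p \<noteq> c}"

definition graph_edges :: "('a \<Rightarrow> ('r, 'e, 'v) point set) \<Rightarrow> colour \<Rightarrow> 'a set" where
  "graph_edges ends c = {a. edge_colour ends a = c}"

section \<open>Spanning trees of multigraphs\<close>

text \<open>
  The notions of forest and tree in \<open>Graph_Theory\<close> are about directed cycles, hence do not apply.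
  A pair of parallel edges is a cycle (of length 2).
\<close>

definition is_cycle :: "('a \<Rightarrow> 'p set) \<Rightarrow> 'p list \<Rightarrow> 'a list \<Rightarrow> bool" where
  "is_cycle ends ps as \<longleftrightarrow>
     as \<noteq> [] \<and> length ps = length as \<and> distinct ps \<and> distinct as \<and>
     (\<forall>i < length as. ends (as ! i) = {ps ! i, ps ! (Suc i mod length as)})"

definition is_tree :: "('a \<Rightarrow> 'p set) \<Rightarrow> 'p set \<Rightarrow> 'a set \<Rightarrow> bool" where
  "is_tree ends U F \<longleftrightarrow>
     (\<forall>a\<in>F. ends a \<subseteq> U) \<and> U \<noteq> {} \<and>
     (\<forall>p\<in>U. \<forall>q\<in>U. (p, q) \<in> (joined ends F)\<^sup>*) \<and>
     (\<nexists>ps as. is_cycle ends ps as \<and> set as \<subseteq> F)"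

text \<open>\<open>F\<close> is the edge set of a spanning tree of the graph with points \<open>U\<close> and edges \<open>A\<close>.\<close>

definition is_spanning_tree :: "('a \<Rightarrow> 'p set) \<Rightarrow> 'p set \<Rightarrow> 'a set \<Rightarrow> 'a set \<Rightarrow> bool" where
  "is_spanning_tree ends U A F \<longleftrightarrow> F \<subseteq> A \<and> is_tree ends U F"

definition degree_in :: "('a \<Rightarrow> 'p set) \<Rightarrow> 'a set \<Rightarrow> 'p \<Rightarrow> nat" where
  "degree_in ends F p = card {a\<in>F. p \<in> ends a}"

section \<open>Hypertrees\<close>

text \<open>
  The hypergraph \<open>(V, E)\<close> is the one induced by \<open>G\<^sub>R\<close>: its hyperedges are the neighbourhoods in
  \<open>G\<^sub>R\<close> of the emerald points.
\<close>

definition hypertree :: "('a \<Rightarrow> ('r, 'e, 'v) point set) \<Rightarrow> ('e \<Rightarrow> nat) \<Rightarrow> bool" where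
  "hypertree ends f \<longleftrightarrow>
     (\<exists>F. is_spanning_tree ends (graph_points Red) (graph_edges ends Red) F \<and>
          (\<forall>e. degree_in ends F (EmeraldPt e) = f e + 1))"

definition real_vector_of :: "('e::finite \<Rightarrow> nat) \<Rightarrow> real ^ 'e" where
  "real_vector_of f = (\<chi> e. real (f e))"

definition hypertree_polytope ::
    "('a \<Rightarrow> ('r, 'e::finite, 'v) point set) \<Rightarrow> (real ^ 'e) set" where
  "hypertree_polytope ends = convex hull (real_vector_of ` {f. hypertree ends f})"

definition integer_vectors :: "(real ^ 'e::finite) set" where
  "integer_vectors = {x. \<forall>e. vec_nth x e \<in> \<int>}"

section \<open>The enhanced adjacency matrix\<close>

text \<open>
  The polynomial ring \<open>\<int>[E]\<close>: exponent vectors are finitely supported functions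
  \<^typ>\<open>'e \<Rightarrow>\<^sub>0 nat\<close>, and a polynomial assigns integer coefficients to finitely many of these.
\<close>

type_synonym 'e int_poly = "('e \<Rightarrow>\<^sub>0 nat) \<Rightarrow>\<^sub>0 int"

definition indeterminate :: "'e \<Rightarrow> 'e int_poly" where
  "indeterminate e = Poly_Mapping.single (Poly_Mapping.single e 1) 1"

definition emerald_corner ::
    "('a \<Rightarrow> ('r, 'e, 'v) point set) \<Rightarrow> ('t \<Rightarrow> 'a set) \<Rightarrow> 't \<Rightarrow> 'e" where
  "emerald_corner ends sides t = (THE e. EmeraldPt e \<in> corners ends sides t)"

definition enhanced_entry ::
    "('a \<Rightarrow> ('r, 'e, 'v) point set) \<Rightarrow> ('t \<Rightarrow> 'a set) \<Rightarrow> ('r, 'e, 'v) point \<Rightarrow> 't \<Rightarrow> 'e int_poly"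
  where
  "enhanced_entry ends sides p t =
     (if p \<notin> corners ends sides t then 0
      else if colour_of p = Violet then indeterminate (emerald_corner ends sides t)
      else 1)"

text \<open>
  The lists \<open>ps\<close> and \<open>ts\<close> enumerate the rows (non-root points) and the columns (non-outer white
  triangles).
\<close>

definition enhanced_matrix ::
    "('a \<Rightarrow> ('r, 'e, 'v) point set) \<Rightarrow> ('t \<Rightarrow> 'a set) \<Rightarrow>
     ('r, 'e, 'v) point list \<Rightarrow> 't list \<Rightarrow> 'e int_poly mat" where
  "enhanced_matrix ends sides ps ts =
     Matrix.mat (length ps) (length ts) (\<lambda>(i, j). enhanced_entry ends sides (ps ! i) (ts ! j))"

end

theory Submission
  imports Defs
begin

text \<open>
  White triangles correspond to edges of \<open>G\<^sub>R\<close>. An expansion term of the determinant matches the non-root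
  red points to a set \<open>S\<close> of white triangles, one at each of them, and its exponent vector is given by
  the emerald degrees of the complement of \<open>S\<close>. Hence the coefficient of a monomial is a sum over such \<open>S\<close>
  of signed numbers of matchings, and each of these numbers is a real determinant. The kernel of the matrix
  consists of circulations on \<open>G\<^sub>R\<close>; as the sphere has no homology in degree 1, these are differences
  of potentials on \<open>R\<close>. If the dual edges of \<open>S\<close> do not form a spanning arborescence rooted at \<open>r\<^sub>0\<close>, then a
  potential constant along \<open>S\<close> makes the matrix singular. For arborescences, the matrices are joined
  by segments on which the maximum principle excludes a kernel, so their determinants have the same
  sign, and there is only one matching for each of them.

  It remains to see that each hypertree \<open>f\<close> comes from exactly one arborescence. Uniqueness
  holds since a circulation that is nonnegative outside one complementary tree and nonpositive outside
  another one is zero. For existence, an optimal flow with supplies \<open>f e + 1 / |E|\<close> and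
  unit demands is supported in the complement of an arborescence. Having such a flow is a convex
  condition on \<open>f\<close>, so this also shows that all integer points of the polytope are hypertrees.
\<close>

text \<open>The obstacle is the comparison of signs between expansion terms of different
  arborescences: their permutations are unrelated, and exchanging edges one at a time would call for
  planar pictures. Over the reals, continuity replaces the exchange, since only nonvanishing along a
  segment has to be shown. For the same reason genus zero enters as a mere count: Euler's formula
  makes face boundaries and coboundaries fill the space of functions on edges, and the geometry is
  then used through potentials of circulations and numbers of edges.

  The constant \<open>1 / CARD('e)\<close> balances the flow. The degrees \<open>f e + 1\<close> of
  a spanning tree sum to |E| + |V| - 1, so \<open>f\<close> sums to |V| - 1, one unit short of the
  demand. Spreading this unit evenly singles out no emerald point, and it leaves a positive excess
  at each of them; as no edge carries more than its unit demand, more than \<open>f e\<close> edges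
  at \<open>e\<close> must carry flow.\<close>

lemma sum_fibres:
  fixes g :: "'b::finite \<Rightarrow> real"
  assumes "finite A"
  shows "(\<Sum>x\<in>A. c x * g (p x)) = (\<Sum>y\<in>UNIV. g y * (\<Sum>x\<in>{x\<in>A. p x = y}. c x))"
proof -
  have "(\<Sum>y\<in>UNIV. \<Sum>x\<in>{x\<in>A. p x = y}. c x * g (p x)) = (\<Sum>x\<in>A. c x * g (p x))"
    by (rule sum.group) (use assms in auto)
  moreover have "(\<Sum>x\<in>{x\<in>A. p x = y}. c x * g (p x)) = g y * (\<Sum>x\<in>{x\<in>A. p x = y}. c x)" for y
    by (simp add: sum_distrib_left mult.commute)
  ultimately show ?thesis by simp
qed

lemma dim_coordinate_subspace:
  "dim {x :: real ^ 'n. \<forall>i. i \<notin> d \<longrightarrow> vec_nth x i = 0} = card d"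
  using dim_substandard_cart[of d, where 'a = real] by (simp add: dim_vec_eq)

section \<open>Circulations on a plane bipartite graph\<close>

text \<open>
  The set \<open>W\<close> of white triangles stands for the edges of \<open>G\<^sub>R\<close>: the edge of \<open>t\<close> joins \<open>eo t\<close> to \<open>vi t\<close>, and
  its dual edge is directed from \<open>br t\<close>, the red corner of the black triangle across it, to \<open>wr t\<close>,
  the red corner of \<open>t\<close>. The first two axioms say that the boundary of a face of \<open>G\<^sub>R\<close> is a cycle.
\<close>

locale planar_web =
  fixes W :: "'t::finite set" and wr br :: "'t \<Rightarrow> 'r::finite"
    and eo :: "'t \<Rightarrow> 'e::finite" and vi :: "'t \<Rightarrow> 'v::finite" and r\<^sub>0 :: 'r
  assumes balance_e: "card {t\<in>W. eo t = e \<and> wr t = r} = card {t\<in>W. eo t = e \<and> br t = r}"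
    and balance_v: "card {t\<in>W. vi t = v \<and> wr t = r} = card {t\<in>W. vi t = v \<and> br t = r}"
    and primal_connected: "(\<And>t. t \<in> W \<Longrightarrow> ke (eo t) = (kv (vi t) :: real)) \<Longrightarrow> \<exists>c. (\<forall>e. ke e = c) \<and> (\<forall>v. kv v = c)"
    and dual_connected: "(\<And>t. t \<in> W \<Longrightarrow> h (wr t) = (h (br t) :: real)) \<Longrightarrow> \<exists>c. \<forall>r. h r = c"
    and euler_W: "card W + 2 = CARD('r) + CARD('e) + CARD('v)"
begin

text \<open>All edges of G_R are directed from E to V, so Kirchhoff's law has no signs: the values
  around a point sum to zero. Circulations form the real cycle space of G_R.\<close>

definition circulation :: "('t \<Rightarrow> real) \<Rightarrow> bool" where
  "circulation c \<longleftrightarrow> (\<forall>e. (\<Sum>t\<in>{t\<in>W. eo t = e}. c t) = 0) \<and> (\<forall>v. (\<Sum>t\<in>{t\<in>W. vi t = v}. c t) = 0)"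

lemma circulation_cong: "circulation c \<Longrightarrow> (\<And>t. t \<in> W \<Longrightarrow> c t = c' t) \<Longrightarrow> circulation c'"
  unfolding circulation_def by (simp cong: sum.cong_simp conj_cong)

lemma circulation_diff: "circulation c \<Longrightarrow> circulation d \<Longrightarrow> circulation (\<lambda>t. c t - d t)"
  by (simp add: circulation_def sum_subtractf)

text \<open>The function is the sum of the face boundaries of G_R with weights \<open>h\<close>. By
  the balance axioms, each face has equally many edges at a point on the white and on the black
  side, and they cancel.\<close>

lemma circulation_potential: "circulation (\<lambda>t. h (wr t) - h (br t))"
proof -
  have *: "(\<Sum>t\<in>{t\<in>W. P t}. h (q t)) = (\<Sum>r\<in>UNIV. h r * real (card {t\<in>W. P t \<and> q t = r}))" for P q
    using sum_fibres[of "{t\<in>W. P t}" "\<lambda>_. 1" h q] by simp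
  show ?thesis
    unfolding circulation_def by (simp add: sum_subtractf * balance_e balance_v)
qed

text \<open>Cycles are orthogonal to coboundaries: collecting terms by the ends of the edges leaves
  the sums of \<open>c\<close> around points, which vanish.\<close>

lemma circulation_orthogonal:
  assumes "circulation c"
  shows "(\<Sum>t\<in>W. c t * (kv (vi t) - ke (eo t))) = 0"
  using assms sum_fibres[of W c kv vi] sum_fibres[of W c ke eo]
  by (simp add: circulation_def right_diff_distrib sum_subtractf)

text \<open>A coboundary sums to zero around the face of \<open>r\<close>, whose boundary traverses
  the edges with \<open>wr t = r\<close> in one direction and those with \<open>br t = r\<close> in
  the other.\<close>

lemma cut_balanced:
  fixes ke :: "'e \<Rightarrow> real" and kv :: "'v \<Rightarrow> real"
  shows "(\<Sum>t\<in>{t\<in>W. wr t = r}. kv (vi t) - ke (eo t)) = (\<Sum>t\<in>{t\<in>W. br t = r}. kv (vi t) - ke (eo t))"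
proof -
  have e: "(\<Sum>t\<in>{t\<in>W. P t}. ke (eo t)) = (\<Sum>e\<in>UNIV. ke e * real (card {t\<in>W. eo t = e \<and> P t}))" for P
    using sum_fibres[of "{t\<in>W. P t}" "\<lambda>_. 1" ke eo] by (simp add: conj_ac)
  have v: "(\<Sum>t\<in>{t\<in>W. P t}. kv (vi t)) = (\<Sum>v\<in>UNIV. kv v * real (card {t\<in>W. vi t = v \<and> P t}))" for P
    using sum_fibres[of "{t\<in>W. P t}" "\<lambda>_. 1" kv vi] by (simp add: conj_ac)
  show ?thesis
    by (simp add: sum_subtractf e v balance_e balance_v)
qed

text \<open>
  The first homology of the sphere vanishes. Here this comes from Euler's formula: coboundaries and
  boundaries are orthogonal, and their dimensions add up to the number of edges.
\<close>

definition potential_map :: "real ^ ('r + 'e + 'v) \<Rightarrow> real ^ 't" where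
  "potential_map x = (\<chi> t. if t \<in> W then
      (vec_nth x (Inl (wr t)) - vec_nth x (Inl (br t))) +
      (vec_nth x (Inr (Inr (vi t))) - vec_nth x (Inr (Inl (eo t)))) else 0)"

text \<open>Fixing one red and one violet value at 0 removes the kernel of
  \<open>potential_map\<close>: a constant on R, and a common constant on E and V. Here
  \<open>undefined\<close> is just some violet point. The remaining coordinates number
  \<open>card W\<close> by Euler's formula.\<close>

definition grounded :: "(real ^ ('r + 'e + 'v)) set" where
  "grounded = {x. \<forall>i. i \<notin> UNIV - {Inl r\<^sub>0, Inr (Inr undefined)} \<longrightarrow> vec_nth x i = 0}"

lemma linear_potential_map: "linear potential_map"
  by (rule linearI) (auto simp: potential_map_def Finite_Cartesian_Product.vec_eq_iff algebra_simps)

lemma subspace_grounded: "subspace grounded"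
  by (auto simp: grounded_def subspace_def)

text \<open>The two summands of \<open>potential_map\<close> are a circulation and a coboundary,
  hence orthogonal. If they add up to zero, each is orthogonal to itself and vanishes; connectedness
  then makes the potentials constant, and grounding makes them zero.\<close>

lemma inj_on_potential_map: "inj_on potential_map grounded"
proof -
  have "x = 0" if x: "x \<in> grounded" "potential_map x = 0" for x
  proof -
    define h ke kv where "h r = vec_nth x (Inl r)" and "ke e = vec_nth x (Inr (Inl e))"
      and "kv v = vec_nth x (Inr (Inr v))" for r e v
    have g: "h r\<^sub>0 = 0" "kv undefined = 0" using x(1) by (auto simp: grounded_def h_def kv_def)
    have eq: "(h (wr t) - h (br t)) + (kv (vi t) - ke (eo t)) = 0" if "t \<in> W" for t
      using x(2) that by (auto simp: potential_map_def Finite_Cartesian_Product.vec_eq_iff h_def ke_def kv_def dest: spec[of _ t])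
    have "(\<Sum>t\<in>W. (h (wr t) - h (br t)) * (kv (vi t) - ke (eo t))) = 0"
      by (rule circulation_orthogonal[OF circulation_potential])
    also have "(\<Sum>t\<in>W. (h (wr t) - h (br t)) * (kv (vi t) - ke (eo t))) = - (\<Sum>t\<in>W. (h (wr t) - h (br t))\<^sup>2)"
      unfolding sum_negf[symmetric]
    proof (rule sum.cong)
      fix t assume "t \<in> W"
      from eq[OF this] have "kv (vi t) - ke (eo t) = - (h (wr t) - h (br t))" by linarith
      then show "(h (wr t) - h (br t)) * (kv (vi t) - ke (eo t)) = - (h (wr t) - h (br t))\<^sup>2"
        by (simp only: power2_eq_square mult_minus_right)
    qed simp
    finally have z: "h (wr t) = h (br t)" if "t \<in> W" for t
      using that by (simp add: sum_nonneg_eq_0_iff)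
    then have "ke (eo t) = kv (vi t)" if "t \<in> W" for t using eq[OF that] that by simp
    from dual_connected[of h, OF z] primal_connected[of ke kv, OF this] g
    have "h r = 0" "ke e = 0" "kv v = 0" for r e v by metis+
    then show "x = 0" unfolding Finite_Cartesian_Product.vec_eq_iff h_def ke_def kv_def
      by (metis sum.exhaust_sel zero_index)
  qed
  then show ?thesis
    by (metis linear_inj_on_iff_eq_0 linear_potential_map subspace_grounded)
qed

lemma image_potential_map: "potential_map ` grounded = {c. \<forall>t. t \<notin> W \<longrightarrow> vec_nth c t = 0}" (is "_ = ?L")
proof (rule subspace_dim_equal)
  show "subspace (potential_map ` grounded)"
    by (rule linear_subspace_image[OF linear_potential_map subspace_grounded])
  show "subspace ?L" by (auto simp: subspace_def)
  show "potential_map ` grounded \<subseteq> ?L" by (auto simp: potential_map_def)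
  have "dim (potential_map ` grounded) = dim grounded"
    by (rule dim_image_eq[OF linear_potential_map])
       (simp add: span_eq_iff[THEN iffD2, OF subspace_grounded] inj_on_potential_map)
  also have "\<dots> = card (UNIV - {Inl r\<^sub>0 :: 'r + 'e + 'v, Inr (Inr undefined)})"
    unfolding grounded_def by (rule dim_coordinate_subspace)
  also have "\<dots> = card W"
    using euler_W by (simp add: card_Diff_subset card_UNIV_sum)
  finally show "dim ?L \<le> dim (potential_map ` grounded)"
    by (simp add: dim_coordinate_subspace)
qed

text \<open>By surjectivity, \<open>c\<close> is a difference of potentials on R plus a coboundary.
  The latter is a difference of circulations, so it is a circulation orthogonal to itself.\<close>

lemma circulation_exact:
  assumes "circulation c"
  obtains h where "\<And>t. t \<in> W \<Longrightarrow> c t = h (wr t) - h (br t)"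
proof -
  have "(\<chi> t. if t \<in> W then c t else 0) \<in> potential_map ` grounded"
    unfolding image_potential_map by simp
  then obtain x where x: "(\<chi> t. if t \<in> W then c t else 0) = potential_map x" by blast
  define h ke kv where "h r = vec_nth x (Inl r)" and "ke e = vec_nth x (Inr (Inl e))"
    and "kv v = vec_nth x (Inr (Inr v))" for r e v
  have c: "c t = (h (wr t) - h (br t)) + (kv (vi t) - ke (eo t))" if "t \<in> W" for t
    using x that by (auto simp: potential_map_def Finite_Cartesian_Product.vec_eq_iff h_def ke_def kv_def dest: spec[of _ t])
  have "circulation (\<lambda>t. c t - (h (wr t) - h (br t)))"
    by (rule circulation_diff[OF assms circulation_potential])
  from circulation_orthogonal[OF this, of kv ke]
  have "(\<Sum>t\<in>W. (kv (vi t) - ke (eo t))\<^sup>2) = 0"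
    by (simp add: c power2_eq_square cong: sum.cong)
  then have "kv (vi t) - ke (eo t) = 0" if "t \<in> W" for t
    using that by (simp add: sum_nonneg_eq_0_iff)
  with c show thesis by (intro that[of h]) simp
qed

section \<open>Arborescences in the dual graph\<close>

text \<open>The rank function \<open>d\<close> excludes directed cycles, so that all points are reached from the root.\<close>

definition arborescence :: "'t set \<Rightarrow> bool" where
  "arborescence S \<longleftrightarrow> S \<subseteq> W \<and> bij_betw wr S (UNIV - {r\<^sub>0}) \<and>
     (\<exists>d. \<forall>t\<in>S. d (br t) < (d (wr t) :: nat))"

lemma arborescence_induct:
  assumes "arborescence S" "P r\<^sub>0" "\<And>t. t \<in> S \<Longrightarrow> P (br t) \<Longrightarrow> P (wr t)"
  shows "P r"
proof -
  obtain d where d: "\<forall>t\<in>S. d (br t) < (d (wr t) :: nat)" and b: "bij_betw wr S (UNIV - {r\<^sub>0})"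
    using assms(1) unfolding arborescence_def by blast
  show ?thesis
  proof (induction r rule: measure_induct_rule[of d])
    case (less r)
    show ?case
    proof (cases "r = r\<^sub>0")
      case False
      then obtain t where "t \<in> S" "wr t = r" using b by (metis DiffI UNIV_I bij_betw_iff_bijections singletonD)
      then show ?thesis using less d assms(3) by blast
    qed (use assms(2) in simp)
  qed
qed

text \<open>The complement has the number of edges of a spanning tree of G_R.\<close>

lemma card_arborescence:
  assumes "arborescence S"
  shows "card (W - S) + 1 = CARD('e) + CARD('v)"
proof -
  have "card S = CARD('r) - 1" "S \<subseteq> W"
    using assms bij_betw_same_card[of wr S] by (auto simp: arborescence_def card_Diff_subset)
  moreover have "card S + card (W - S) = card W"
    using \<open>S \<subseteq> W\<close> by (metis card_Diff_subset card_mono finite le_add_diff_inverse)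
  ultimately show ?thesis using euler_W zero_less_card_finite[where 'a = 'r] by linarith
qed

lemma potential_constant:
  assumes "arborescence S" "\<And>t. t \<in> S \<Longrightarrow> h (wr t) = h (br t)"
  shows "h r = h r\<^sub>0"
  by (rule arborescence_induct[OF assms(1)]) (simp_all add: assms(2))

text \<open>This is acyclicity of the complement of \<open>S\<close>: a circulation supported there
  has a potential that is constant along \<open>S\<close>, hence constant.\<close>

lemma circulation_zero:
  assumes "arborescence S" "circulation c" "\<And>t. t \<in> S \<Longrightarrow> c t = 0" "t \<in> W"
  shows "c t = 0"
proof -
  obtain h where h: "\<And>t. t \<in> W \<Longrightarrow> c t = h (wr t) - h (br t)"
    using circulation_exact[OF assms(2)] by blast
  have "h (wr t) = h (br t)" if "t \<in> S" for t
    using h[of t] assms(1,3) that by (auto simp: arborescence_def)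
  from potential_constant[OF assms(1), where h = h, OF this] h[OF assms(4)] show ?thesis
    by (metis cancel_comm_monoid_add_class.diff_cancel)
qed

text \<open>An edge of \<open>S\<close> on which the potential jumps and which is deepest in \<open>S\<close> violates the balance at its head.\<close>

lemma complement_connected:
  assumes S: "arborescence S" and eq: "\<And>t. t \<in> W - S \<Longrightarrow> ke (eo t) = (kv (vi t) :: real)"
  shows "\<exists>c. (\<forall>e. ke e = c) \<and> (\<forall>v. kv v = c)"
proof (rule primal_connected)
  obtain d where d: "\<forall>t\<in>S. d (br t) < (d (wr t) :: nat)" and SW: "S \<subseteq> W" and inj: "inj_on wr S"
    using S unfolding arborescence_def bij_betw_def by blast
  define z where "z t = kv (vi t) - ke (eo t)" for t
  have nz: "t \<in> S" if "t \<in> W" "z t \<noteq> 0" for t using eq that unfolding z_def by fastforce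
  show "ke (eo t) = kv (vi t)" if "t \<in> W" for t
  proof (rule ccontr)
    assume "ke (eo t) \<noteq> kv (vi t)"
    then have "{t\<in>W. z t \<noteq> 0} \<noteq> {}" using that by (auto simp: z_def)
    then obtain s where s: "s \<in> W" "z s \<noteq> 0" and max: "\<And>t. t \<in> W \<Longrightarrow> z t \<noteq> 0 \<Longrightarrow> d (wr t) \<le> d (wr s)"
      using arg_max_on_def Max_in[of "(\<lambda>t. d (wr t)) ` {t\<in>W. z t \<noteq> 0}"]
        Max_ge[of "(\<lambda>t. d (wr t)) ` {t\<in>W. z t \<noteq> 0}"] by fastforce
    have "(\<Sum>t\<in>{t\<in>W. wr t = wr s}. z t) = (\<Sum>t\<in>{s}. z t)"
      by (rule sum.mono_neutral_right) (use s nz inj in \<open>auto dest: inj_onD\<close>)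
    moreover have "(\<Sum>t\<in>{t\<in>W. br t = wr s}. z t) = 0"
      by (rule sum.neutral) (use max nz d in force)
    ultimately show False using cut_balanced[where r = "wr s" and kv = kv and ke = ke] s by (simp add: z_def)
  qed
qed

section \<open>Existence and uniqueness of arborescences\<close>

definition reached :: "'t set \<Rightarrow> 'r set" where
  "reached S = {r. (r\<^sub>0, r) \<in> {(br t, wr t) | t. t \<in> S}\<^sup>*}"

lemma reached_root: "r\<^sub>0 \<in> reached S"
  by (simp add: reached_def)

lemma reached_step: "t \<in> S \<Longrightarrow> br t \<in> reached S \<Longrightarrow> wr t \<in> reached S"
  unfolding reached_def by (auto intro: rtrancl_into_rtrancl)

lemma reached_cases:
  assumes "r \<in> reached S" "r \<noteq> r\<^sub>0"
  obtains t where "t \<in> S" "wr t = r" "br t \<in> reached S"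
  using assms by (auto simp: reached_def elim: rtranclE)

text \<open>Breadth-first search: \<open>d\<close> is the distance from the root, and
  \<open>k r\<close> is the last edge of a shortest directed path to \<open>r\<close>.\<close>

lemma arborescence_exists:
  assumes "S \<subseteq> W" "reached S = UNIV"
  obtains A where "arborescence A" "A \<subseteq> S"
proof -
  define E where "E = {(br t, wr t) | t. t \<in> S}"
  define d where "d r = (LEAST n. (r\<^sub>0, r) \<in> E ^^ n)" for r
  have ex: "\<exists>n. (r\<^sub>0, r) \<in> E ^^ n" for r
    using assms(2) by (auto simp: reached_def E_def rtrancl_power)
  have "\<exists>t\<in>S. wr t = r \<and> d (br t) < d r" if r: "r \<noteq> r\<^sub>0" for r
  proof -
    have n: "(r\<^sub>0, r) \<in> E ^^ d r" unfolding d_def by (rule LeastI_ex[OF ex])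
    then obtain m where m: "d r = Suc m" using r by (cases "d r") auto
    with n obtain t where t: "t \<in> S" "wr t = r" "(r\<^sub>0, br t) \<in> E ^^ m" by (auto simp: E_def)
    then have "d (br t) \<le> m" unfolding d_def by (intro Least_le)
    with t m show ?thesis by auto
  qed
  then obtain k where k: "\<And>r. r \<noteq> r\<^sub>0 \<Longrightarrow> k r \<in> S \<and> wr (k r) = r \<and> d (br (k r)) < d r" by metis
  have "arborescence (k ` (UNIV - {r\<^sub>0}))"
    unfolding arborescence_def
  proof (intro conjI exI[of _ d])
    show "bij_betw wr (k ` (UNIV - {r\<^sub>0})) (UNIV - {r\<^sub>0})"
      using k by (auto simp: bij_betw_def inj_on_def image_image)
  qed (use k assms(1) in auto)
  then show thesis using k by (intro that) auto
qed

text \<open>Away from the root, the potential of \<open>c\<close> cannot increase along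
  \<open>S\<close> and cannot decrease along \<open>S'\<close>. Both arborescences reach every red
  point, so the potential is constant.\<close>

lemma circulation_compatible:
  assumes S: "arborescence S" "arborescence S'" and c: "circulation c"
    and pos: "\<And>t. t \<in> S \<Longrightarrow> c t \<le> 0" and neg: "\<And>t. t \<in> S' \<Longrightarrow> 0 \<le> c t" and t: "t \<in> W"
  shows "c t = 0"
proof -
  obtain h where h: "\<And>t. t \<in> W \<Longrightarrow> c t = h (wr t) - h (br t)"
    using circulation_exact[OF c] by blast
  have "h r \<le> h r\<^sub>0" for r
    by (rule arborescence_induct[OF S(1)])
       (use h pos S in \<open>fastforce simp: arborescence_def\<close>)+
  moreover have "h r\<^sub>0 \<le> h r" for r
    by (rule arborescence_induct[OF S(2)])
       (use h neg S in \<open>fastforce simp: arborescence_def\<close>)+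
  ultimately show ?thesis using h[OF t] by (metis cancel_comm_monoid_add_class.diff_cancel order_antisym)
qed

text \<open>
  In the directed graph with the edges outside \<open>S\<close> from \<open>E\<close> to \<open>V\<close> and those outside \<open>S'\<close> from \<open>V\<close> to
  \<open>E\<close>, a closed walk is a circulation to which \<open>circulation_compatible\<close> applies, so it uses common
  edges only. A minimal set without incoming edges is then a component of both complements.
\<close>

lemma arborescence_unique:
  assumes S: "arborescence S" "arborescence S'"
    and deg: "\<And>e. card {t \<in> W - S. eo t = e} = card {t \<in> W - S'. eo t = e}"
  shows "S = S'"
proof -
  define T T' where "T = W - S" and "T' = W - S'"
  define D where "D = {(Inl (eo t) :: 'e + 'v, Inr (vi t)) | t. t \<in> T} \<union> {(Inr (vi t), Inl (eo t)) | t. t \<in> T'}"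
  \<comment> \<open>\<open>a\<close> and \<open>b\<close> count how often a walk from
    \<open>u\<close> to \<open>w\<close> uses the edges of \<open>T\<close> and \<open>T'\<close>,
    so \<open>a - b\<close> is a unit flow from \<open>u\<close> to \<open>w\<close>. The signs at
    violet points are reversed because the edges are directed from E to V.\<close>
  have path: "\<exists>a b. (\<forall>t. 0 \<le> a t \<and> 0 \<le> b t \<and> (a t \<noteq> 0 \<longrightarrow> t \<in> T) \<and> (b t \<noteq> 0 \<longrightarrow> t \<in> T')) \<and>
      (\<forall>e. (\<Sum>t\<in>{t\<in>W. eo t = e}. a t - b t) = of_bool (u = Inl e) - of_bool (w = Inl e)) \<and>
      (\<forall>v. (\<Sum>t\<in>{t\<in>W. vi t = v}. a t - b t) = (of_bool (w = Inr v) - of_bool (u = Inr v) :: real))"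
    if "(u, w) \<in> D\<^sup>*" for u w
    using that
  proof (induction rule: rtrancl_induct)
    case base
    show ?case by (intro exI[of _ "\<lambda>_. 0"]) simp
  next
    case (step y z)
    then obtain a b where ab: "\<forall>t. 0 \<le> a t \<and> 0 \<le> b t \<and> (a t \<noteq> 0 \<longrightarrow> t \<in> T) \<and> (b t \<noteq> 0 \<longrightarrow> t \<in> T')"
      "\<And>e. (\<Sum>t\<in>{t\<in>W. eo t = e}. a t - b t) = of_bool (u = Inl e) - of_bool (y = Inl e)"
      "\<And>v. (\<Sum>t\<in>{t\<in>W. vi t = v}. a t - b t) = (of_bool (y = Inr v) - of_bool (u = Inr v) :: real)"
      by blast
    have single: "(\<Sum>t\<in>{t\<in>W. P t}. of_bool (t = s)) = (of_bool (P s) :: real)" if "s \<in> W" for P s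
      using that by (simp add: of_bool_def)
    from step(2) consider s where "s \<in> T" "y = Inl (eo s)" "z = Inr (vi s)"
      | s where "s \<in> T'" "y = Inr (vi s)" "z = Inl (eo s)"
      unfolding D_def by blast
    then show ?case
    proof cases
      case 1
      have sW: "s \<in> W" using 1 by (simp add: T_def)
      have split: "(\<Sum>t\<in>{t\<in>W. P t}. (a t + of_bool (t = s)) - b t) = (\<Sum>t\<in>{t\<in>W. P t}. a t - b t) + of_bool (P s)" for P
        using single[OF sW, of P] by (simp add: sum.distrib sum_subtractf)
      show ?thesis
      proof (rule exI[of _ "\<lambda>t. a t + of_bool (t = s)"], rule exI[of _ b], intro conjI allI)
        fix t
        show "0 \<le> a t + of_bool (t = s)" "0 \<le> b t" "b t \<noteq> 0 \<longrightarrow> t \<in> T'" using ab(1) by simp_all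
        show "a t + of_bool (t = s) \<noteq> 0 \<longrightarrow> t \<in> T" using ab(1) 1 by (cases "t = s") auto
      qed (simp_all only: split ab 1 sum.inject simp_thms, simp_all)
    next
      case 2
      have sW: "s \<in> W" using 2 by (simp add: T'_def)
      have split: "(\<Sum>t\<in>{t\<in>W. P t}. a t - (b t + of_bool (t = s))) = (\<Sum>t\<in>{t\<in>W. P t}. a t - b t) - of_bool (P s)" for P
        using single[OF sW, of P] by (simp add: sum.distrib sum_subtractf)
      show ?thesis
      proof (rule exI[of _ a], rule exI[of _ "\<lambda>t. b t + of_bool (t = s)"], intro conjI allI)
        fix t
        show "0 \<le> b t + of_bool (t = s)" "0 \<le> a t" "a t \<noteq> 0 \<longrightarrow> t \<in> T" using ab(1) by simp_all
        show "b t + of_bool (t = s) \<noteq> 0 \<longrightarrow> t \<in> T'" using ab(1) 2 by (cases "t = s") auto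
      qed (simp_all only: split ab 2 sum.inject simp_thms, simp_all)
    qed
  qed
  \<comment> \<open>The edge \<open>t\<close> closes the walk to a circulation, which vanishes at
    \<open>t\<close>. The contribution of \<open>t\<close> must therefore be cancelled by a use of
    \<open>t\<close> in the other direction, and this puts \<open>t\<close> into the other tree
    too.\<close>
  have closed: "t \<in> T \<inter> T'" if t: "t \<in> T \<and> (Inr (vi t), Inl (eo t)) \<in> D\<^sup>* \<or> t \<in> T' \<and> (Inl (eo t), Inr (vi t)) \<in> D\<^sup>*" for t
  proof -
    have tW: "t \<in> W" using t by (auto simp: T_def T'_def)
    have single: "(\<Sum>s\<in>{s\<in>W. P s}. of_bool (s = t)) = (of_bool (P t) :: real)" for P
      using tW by (simp add: of_bool_def)
    from t show ?thesis
    proof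
      assume t: "t \<in> T \<and> (Inr (vi t), Inl (eo t)) \<in> D\<^sup>*"
      from path[OF conjunct2[OF t], simplified]
      obtain a b where ab: "\<And>t. 0 \<le> a t \<and> 0 \<le> b t \<and> (a t \<noteq> 0 \<longrightarrow> t \<in> T) \<and> (b t \<noteq> 0 \<longrightarrow> t \<in> T')"
        "\<And>e. (\<Sum>s\<in>{s\<in>W. eo s = e}. a s - b s) = - of_bool (eo t = e)"
        "\<And>v. (\<Sum>s\<in>{s\<in>W. vi s = v}. a s - b s) = (- of_bool (vi t = v) :: real)"
        by blast
      define c where "c s = (a s - b s) + of_bool (s = t)" for s
      have "circulation c"
        unfolding circulation_def c_def using ab by (simp add: sum.distrib single sum_subtractf)
      moreover have "c s \<le> 0" if "s \<in> S" for s
        using ab(1)[of s] that t by (cases "s = t") (auto simp: c_def T_def)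
      moreover have "0 \<le> c s" if "s \<in> S'" for s
        using ab(1)[of s] that by (cases "b s = 0") (auto simp: c_def T'_def)
      ultimately have "c t = 0" using tW by (rule circulation_compatible[OF S])
      then have "b t \<noteq> 0" using ab(1)[of t] by (simp add: c_def)
      then show ?thesis using ab(1)[of t] t by simp
    next
      assume t: "t \<in> T' \<and> (Inl (eo t), Inr (vi t)) \<in> D\<^sup>*"
      from path[OF conjunct2[OF t], simplified]
      obtain a b where ab: "\<And>t. 0 \<le> a t \<and> 0 \<le> b t \<and> (a t \<noteq> 0 \<longrightarrow> t \<in> T) \<and> (b t \<noteq> 0 \<longrightarrow> t \<in> T')"
        "\<And>e. (\<Sum>s\<in>{s\<in>W. eo s = e}. a s - b s) = of_bool (eo t = e)"
        "\<And>v. (\<Sum>s\<in>{s\<in>W. vi s = v}. a s - b s) = (of_bool (vi t = v) :: real)"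
        by blast
      define c where "c s = (a s - b s) - of_bool (s = t)" for s
      have "circulation c"
        unfolding circulation_def c_def using ab by (simp add: single sum_subtractf)
      moreover have "c s \<le> 0" if "s \<in> S" for s
        using ab(1)[of s] that by (cases "a s = 0") (auto simp: c_def T_def)
      moreover have "0 \<le> c s" if "s \<in> S'" for s
        using ab(1)[of s] that t by (cases "s = t") (auto simp: c_def T'_def)
      ultimately have "c t = 0" using tW by (rule circulation_compatible[OF S])
      then have "a t \<noteq> 0" using ab(1)[of t] by (simp add: c_def)
      then show ?thesis using ab(1)[of t] t by simp
    qed
  qed
  define pred where "pred u = {w. (w, u) \<in> D\<^sup>*}" for u
  \<comment> \<open>A predecessor set of least size is strongly connected: the predecessors of any
    of its points form a subset that cannot be smaller.\<close>
  obtain u where min: "\<And>w. card (pred u) \<le> card (pred w)"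
    using ex_has_least_nat[of "\<lambda>_. True" undefined "\<lambda>u. card (pred u)"] by auto
  have pred_closed: "w \<in> pred u" if "(w, x) \<in> D" "x \<in> pred u" for w x
    using that by (auto simp: pred_def intro: converse_rtrancl_into_rtrancl)
  have strong: "(x, y) \<in> D\<^sup>*" if "x \<in> pred u" "y \<in> pred u" for x y
  proof -
    have "pred y \<subseteq> pred u" using that by (auto simp: pred_def)
    then have "pred y = pred u" using min[of y] by (metis card_seteq finite)
    then show ?thesis using that by (auto simp: pred_def)
  qed
  \<comment> \<open>Edges of \<open>T'\<close> enter their emerald end. Those at a point of
    \<open>pred u\<close> thus come from \<open>pred u\<close>, lie on closed walks and belong to
    \<open>T\<close>. As the degrees agree, \<open>T\<close> has no other edges at this
    point.\<close>
  have eT: "t \<in> T'" if t: "t \<in> T" "Inl (eo t) \<in> pred u" for t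
  proof -
    have "s \<in> T" if s: "s \<in> T'" "eo s = eo t" for s
    proof -
      have "(Inr (vi s), Inl (eo t)) \<in> D" using s by (fastforce simp: D_def)
      from this t(2) have "Inr (vi s) \<in> pred u" by (rule pred_closed)
      then have "(Inl (eo s), Inr (vi s)) \<in> D\<^sup>*" using strong t s by simp
      then show ?thesis using closed[of s] s by blast
    qed
    then have "{s \<in> T'. eo s = eo t} \<subseteq> {s \<in> T. eo s = eo t}" by auto
    then have "{s \<in> T'. eo s = eo t} = {s \<in> T. eo s = eo t}"
      using deg[of "eo t"] by (metis T'_def T_def card_subset_eq finite)
    with t show ?thesis by blast
  qed
  have iff: "Inl (eo t) \<in> pred u \<longleftrightarrow> Inr (vi t) \<in> pred u" if t: "t \<in> T" for t
  proof
    assume "Inl (eo t) \<in> pred u"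
    moreover from this have "(Inr (vi t), Inl (eo t)) \<in> D" using eT[OF t] by (auto simp: D_def)
    ultimately show "Inr (vi t) \<in> pred u" by (rule pred_closed[rotated])
  next
    assume "Inr (vi t) \<in> pred u"
    moreover have "(Inl (eo t), Inr (vi t)) \<in> D" using t by (auto simp: D_def)
    ultimately show "Inl (eo t) \<in> pred u" by (rule pred_closed[rotated])
  qed
  have "\<exists>c. (\<forall>e. of_bool (Inl e \<in> pred u) = (c :: real)) \<and> (\<forall>v. of_bool (Inr v \<in> pred u) = c)"
    by (rule complement_connected[OF S(1)]) (use iff in \<open>simp add: T_def\<close>)
  then obtain c where c: "\<And>e. of_bool (Inl e \<in> pred u) = (c :: real)" "\<And>v. of_bool (Inr v \<in> pred u) = c"
    by blast
  have "u \<in> pred u" by (simp add: pred_def)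
  then have "c = 1" using c by (cases u) (metis of_bool_eq(2))+
  then have "Inl e \<in> pred u" for e using c(1)[of e] by (simp split: split_of_bool_asm)
  then have "T \<subseteq> T'" using eT by blast
  moreover have "card T = card T'"
    using card_arborescence S by (metis T'_def T_def add_right_cancel)
  ultimately have "T = T'" by (simp add: card_subset_eq)
  then show ?thesis using S unfolding arborescence_def T_def T'_def by blast
qed

text \<open>
  The flows form a polytope on which we minimise the linear functional that maps the boundary of a
  potential \<open>h\<close> with \<open>h r\<^sub>0 = 0\<close> to the sum of its values. If the dual edges without flow did not reach
  everything from \<open>r\<^sub>0\<close>, then flow could be pushed across the boundary of the set reached. The fractions
  \<open>1 / |E|\<close> in the supplies force every degree to exceed \<open>f\<close>.
\<close>

lemma flow_arborescence:
  assumes pos: "\<And>t. t \<in> W \<Longrightarrow> 0 \<le> x t"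
    and sum_e: "\<And>e. (\<Sum>t\<in>{t\<in>W. eo t = e}. x t) = real (f e) + 1 / CARD('e)"
    and sum_v: "\<And>v. (\<Sum>t\<in>{t\<in>W. vi t = v}. x t) = 1"
  obtains S where "arborescence S" "\<And>e. card {t \<in> W - S. eo t = e} = f e + 1"
proof -
  define K where "K = {x :: real ^ 't. (\<forall>t. 0 \<le> vec_nth x t) \<and> (\<forall>t. t \<notin> W \<longrightarrow> vec_nth x t = 0) \<and>
    (\<forall>e. (\<Sum>t\<in>{t\<in>W. eo t = e}. vec_nth x t) = real (f e) + 1 / CARD('e)) \<and>
    (\<forall>v. (\<Sum>t\<in>{t\<in>W. vi t = v}. vec_nth x t) = 1)}"
  have le1: "vec_nth x t \<le> 1" if "x \<in> K" for x t
  proof (cases "t \<in> W")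
    case True
    then have "vec_nth x t \<le> (\<Sum>s\<in>{s\<in>W. vi s = vi t}. vec_nth x s)"
      using that by (intro member_le_sum) (auto simp: K_def)
    then show ?thesis using that by (simp add: K_def)
  qed (use that in \<open>simp add: K_def\<close>)
  have "K \<subseteq> cbox (\<chi> t. 0) (\<chi> t. 1)"
    using le1 by (auto simp: mem_box_cart) (simp add: K_def)
  then have "bounded K" using bounded_cbox bounded_subset by blast
  moreover have "closed K"
    unfolding K_def
    by (intro closed_Collect_conj closed_Collect_all closed_Collect_imp closed_Collect_le
        closed_Collect_eq open_Collect_const continuous_intros)
  ultimately have "compact K" by (simp add: compact_eq_bounded_closed)
  obtain g where g: "linear g" "\<And>y. y \<in> grounded \<Longrightarrow> g (potential_map y) = y"
    using real_vector.linear_exists_left_inverse_on[OF linear_potential_map subspace_grounded inj_on_potential_map] by blast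
  define \<Phi> where "\<Phi> y = (\<Sum>r\<in>UNIV. vec_nth (g y) (Inl r))" for y
  have lin: "\<Phi> (a - k *\<^sub>R b) = \<Phi> a - k * \<Phi> b" for a b k
    using g(1) by (simp add: \<Phi>_def linear_diff linear_scale sum_subtractf sum_distrib_left)
  have "continuous_on K g"
    using g(1) by (simp add: linear_continuous_on linear_conv_bounded_linear)
  then have "continuous_on K \<Phi>" unfolding \<Phi>_def by (intro continuous_intros)
  moreover have "(\<chi> t. if t \<in> W then x t else 0) \<in> K"
    using pos sum_e sum_v by (simp add: K_def cong: sum.cong_simp conj_cong)
  ultimately obtain y where y: "y \<in> K" and min: "\<And>z. z \<in> K \<Longrightarrow> \<Phi> y \<le> \<Phi> z"
    using continuous_attains_inf[OF \<open>compact K\<close>, of \<Phi>] by blast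
  define Z where "Z = {t\<in>W. vec_nth y t = 0}"
  have "reached Z = UNIV"
  proof (rule ccontr)
    assume "reached Z \<noteq> UNIV"
    define X where "X = - reached Z"
    define u :: "real ^ ('r + 'e + 'v)" where "u = (\<chi> i. case i of Inl r \<Rightarrow> of_bool (r \<in> X) | Inr _ \<Rightarrow> 0)"
    define b where "b = potential_map u"
    have u: "u \<in> grounded" using reached_root by (auto simp: grounded_def u_def X_def)
    have b: "vec_nth b t = (if t \<in> W then of_bool (wr t \<in> X) - of_bool (br t \<in> X) else 0)" for t
      by (simp add: b_def potential_map_def u_def)
    have bpos: "vec_nth y t > 0" if "vec_nth b t > 0" for t
    proof -
      have "t \<in> W" "wr t \<in> X" "br t \<notin> X" using that by (auto simp: b split: if_splits split_of_bool_asm)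
      then have "t \<notin> Z" using reached_step[of t Z] by (auto simp: X_def)
      then show ?thesis using y \<open>t \<in> W\<close> by (simp add: Z_def K_def less_le)
    qed
    \<comment> \<open>\<open>b\<close> is 1 on the edges that enter the unreached set, all of which
      carry flow, and at most 0 elsewhere. So subtracting the least positive flow value does not
      leave \<open>K\<close>. The inserted 1 keeps the minimum defined if no value is
      positive.\<close>
    define \<delta> where "\<delta> = Min (insert 1 {vec_nth y t | t. vec_nth y t > 0})"
    have fin: "finite {vec_nth y t | t. vec_nth y t > 0}" by (rule finite_subset[of _ "range (vec_nth y)"]) auto
    have d: "\<delta> > 0" unfolding \<delta>_def using fin by (subst Min_gr_iff) auto
    have dy: "\<delta> \<le> vec_nth y t" if "vec_nth y t > 0" for t
      unfolding \<delta>_def using fin that by (intro Min_le) auto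
    have "y - \<delta> *\<^sub>R b \<in> K"
    proof -
      have "circulation (vec_nth b)"
        by (rule circulation_cong[OF circulation_potential[of "\<lambda>r. of_bool (r \<in> X)"]]) (simp add: b)
      then have "(\<Sum>t\<in>{t\<in>W. eo t = e}. vec_nth (y - \<delta> *\<^sub>R b) t) = (\<Sum>t\<in>{t\<in>W. eo t = e}. vec_nth y t)"
        "(\<Sum>t\<in>{t\<in>W. vi t = v}. vec_nth (y - \<delta> *\<^sub>R b) t) = (\<Sum>t\<in>{t\<in>W. vi t = v}. vec_nth y t)" for e v
        by (simp_all add: sum_subtractf circulation_def sum_distrib_left[symmetric])
      moreover have "0 \<le> vec_nth (y - \<delta> *\<^sub>R b) t" for t
      proof (cases "vec_nth b t > 0")
        case True
        then have "vec_nth b t = 1" by (auto simp: b split: if_splits split_of_bool_asm)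
        then show ?thesis using dy[OF bpos[OF True]] by simp
      next
        case False
        then have "0 \<le> \<delta> * - vec_nth b t" using d by (intro mult_nonneg_nonneg) auto
        moreover have "0 \<le> vec_nth y t" using y by (simp add: K_def)
        ultimately show ?thesis by simp
      qed
      ultimately show ?thesis using y by (simp add: K_def b)
    qed
    from min[OF this] have "\<delta> * \<Phi> b \<le> 0" by (simp add: lin)
    moreover have "\<Phi> b = real (card X)"
    proof -
      have "g b = u" using g(2)[OF u] by (simp add: b_def)
      then show ?thesis by (simp add: \<Phi>_def u_def)
    qed
    moreover have "card X > 0" using \<open>reached Z \<noteq> UNIV\<close> by (auto simp: X_def card_gt_0_iff)
    ultimately show False using d by (simp add: mult_le_0_iff)
  qed
  moreover have "Z \<subseteq> W" by (auto simp: Z_def)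
  ultimately obtain S where S: "arborescence S" "S \<subseteq> Z"
    using arborescence_exists by blast
  have *: "(\<Sum>t\<in>{t\<in>W. P t}. vec_nth y t) = (\<Sum>t\<in>{t\<in>W - S. P t}. vec_nth y t)" for P
    using S by (intro sum.mono_neutral_right) (auto simp: Z_def)
  have ge: "f e + 1 \<le> card {t \<in> W - S. eo t = e}" for e
  proof -
    have "real (f e) < real (f e) + 1 / CARD('e)" by simp
    also have "\<dots> = (\<Sum>t\<in>{t\<in>W - S. eo t = e}. vec_nth y t)" using y *[of "\<lambda>t. eo t = e"] by (simp add: K_def)
    also have "\<dots> \<le> (\<Sum>t\<in>{t\<in>W - S. eo t = e}. 1)" using le1[OF y] by (intro sum_mono)
    finally show ?thesis by simp
  qed
  \<comment> \<open>Total supply equals total demand, so the numbers \<open>f e + 1\<close> add up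
    to the number of edges outside \<open>S\<close>. Hence no inequality in \<open>ge\<close> is
    strict.\<close>
  have "(\<Sum>t\<in>W. vec_nth y t) = (\<Sum>e\<in>UNIV. real (f e) + 1 / CARD('e))"
    using sum_fibres[of W "vec_nth y" "\<lambda>_. 1" eo] y by (simp add: K_def)
  moreover have "(\<Sum>t\<in>W. vec_nth y t) = CARD('v)"
    using sum_fibres[of W "vec_nth y" "\<lambda>_. 1" vi] y by (simp add: K_def)
  ultimately have "real (\<Sum>e\<in>UNIV. f e) + 1 = CARD('v)" by (simp add: sum.distrib)
  then have "(\<Sum>e\<in>UNIV. f e) + 1 = CARD('v)" by linarith
  then have "(\<Sum>e\<in>UNIV. f e + 1) = card (W - S)"
    using card_arborescence[OF S(1)] by (simp only: sum.distrib) simp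
  also have "\<dots> = (\<Sum>e\<in>UNIV. card {t \<in> W - S. eo t = e})"
    using sum_fibres[of "W - S" "\<lambda>_. 1" "\<lambda>_. 1" eo] by (simp flip: of_nat_sum)
  finally have "f e + 1 = card {t \<in> W - S. eo t = e}" for e
    using ge by (intro sum_mono_inv[of "\<lambda>e. f e + 1" UNIV]) auto
  with S(1) show thesis by (intro that) auto
qed

section \<open>Potentials that are constrained along one or two transversals\<close>

text \<open>\<open>S\<close> has a single edge into each non-root point, so a reached point was
  reached through that edge and its tail is reached as well. The indicator of
  \<open>reached S\<close> is therefore constant along \<open>S\<close>. It is not constant: if
  everything were reached, an arborescence inside \<open>S\<close> would have as many edges as
  \<open>S\<close> and equal it.\<close>

lemma transversal_circulation:
  assumes S: "S \<subseteq> W" "bij_betw wr S (UNIV - {r\<^sub>0})" "\<not> arborescence S"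
  obtains c t where "circulation c" "\<And>t. t \<in> S \<Longrightarrow> c t = 0" "t \<in> W" "c t \<noteq> 0"
proof -
  have "reached S \<noteq> UNIV"
  proof
    assume "reached S = UNIV"
    with S(1) obtain A where A: "arborescence A" "A \<subseteq> S" by (rule arborescence_exists)
    then have "card A = card S"
      using S(2) bij_betw_same_card unfolding arborescence_def by metis
    with A S show False by (metis card_subset_eq finite)
  qed
  then obtain r where r: "r \<notin> reached S" by blast
  define h :: "'r \<Rightarrow> real" where "h r = of_bool (r \<in> reached S)" for r
  have "h (wr t) - h (br t) = 0" if t: "t \<in> S" for t
  proof -
    have "br t \<in> reached S" if "wr t \<in> reached S"
    proof -
      have "wr t \<noteq> r\<^sub>0" using S(2) t by (auto simp: bij_betw_def)
      with that obtain s where "s \<in> S" "wr s = wr t" "br s \<in> reached S" by (rule reached_cases)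
      then show ?thesis using S(2) t by (metis bij_betw_def inj_onD)
    qed
    then show ?thesis using reached_step[OF t] by (auto simp: h_def)
  qed
  moreover obtain t where "t \<in> W" "h (wr t) - h (br t) \<noteq> 0"
  proof (rule ccontr)
    assume "\<not> thesis"
    with that have "\<exists>c. \<forall>r. h r = c" by (intro dual_connected) fastforce
    then have "h r = h r\<^sub>0" by auto
    then show False using r reached_root[of S] by (simp add: h_def)
  qed
  moreover note circulation_potential[of h]
  ultimately show thesis by (intro that)
qed

text \<open>On \<open>R - {r\<^sub>0}\<close> the potential is a weighted mean of its values at the two parents.\<close>

lemma maximum_principle:
  assumes S: "arborescence S" "arborescence S'" and ab: "a > 0" "b \<ge> 0"
    and eq: "\<And>t t'. t \<in> S \<Longrightarrow> t' \<in> S' \<Longrightarrow> wr t = wr t' \<Longrightarrow>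
      a * (h (wr t) - h (br t)) + b * (h (wr t') - h (br t')) = (0 :: real)"
  shows "h r \<le> h r\<^sub>0"
proof -
  define m where "m = Max (range h)"
  have m: "h r \<le> m" for r by (simp add: m_def)
  have "h r = m \<longrightarrow> h r\<^sub>0 = m" for r
  proof (rule arborescence_induct[OF S(1), where P = "\<lambda>r. h r = m \<longrightarrow> h r\<^sub>0 = m"])
    fix t assume t: "t \<in> S" and IH: "h (br t) = m \<longrightarrow> h r\<^sub>0 = m"
    obtain t' where t': "t' \<in> S'" "wr t = wr t'"
      using t S unfolding arborescence_def bij_betw_def by (metis imageE imageI)
    show "h (wr t) = m \<longrightarrow> h r\<^sub>0 = m"
    proof
      assume "h (wr t) = m"
      then have "a * (m - h (br t)) + b * (m - h (br t')) = 0" using eq[OF t t'] t' by simp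
      moreover have "0 \<le> a * (m - h (br t))" "0 \<le> b * (m - h (br t'))"
        using ab m by simp_all
      ultimately have "a * (m - h (br t)) = 0" by linarith
      then show "h r\<^sub>0 = m" using ab IH by simp
    qed
  qed simp
  moreover have "m \<in> range h" unfolding m_def by (intro Max_in) auto
  ultimately show ?thesis using m by (metis imageE)
qed

text \<open>The maximum principle for the potential and its negative makes the potential constant.
  It needs a positive first weight, so the two arborescences change places when
  \<open>a = 0\<close>.\<close>

lemma circulation_mixture_zero:
  assumes S: "arborescence S" "arborescence S'" and ab: "a \<ge> 0" "b \<ge> 0" "a + b > 0"
    and c: "circulation c" and t: "t \<in> W"
    and eq: "\<And>t t'. t \<in> S \<Longrightarrow> t' \<in> S' \<Longrightarrow> wr t = wr t' \<Longrightarrow> a * c t + b * c t' = 0"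
  shows "c t = 0"
proof -
  obtain h where h: "\<And>t. t \<in> W \<Longrightarrow> c t = h (wr t) - h (br t)"
    using circulation_exact[OF c] by blast
  have SW: "S \<subseteq> W" "S' \<subseteq> W" using S by (simp_all add: arborescence_def)
  have eq: "a * (h (wr t) - h (br t)) + b * (h (wr t') - h (br t')) = 0"
    if "t \<in> S" "t' \<in> S'" "wr t = wr t'" for t t'
    using eq[OF that] h that SW by (metis subsetD)
  have eq': "a * (- h (wr t) - - h (br t)) + b * (- h (wr t') - - h (br t')) = 0"
    if "t \<in> S" "t' \<in> S'" "wr t = wr t'" for t t'
    using eq[OF that] by (simp add: algebra_simps)
  have "h r \<le> h r\<^sub>0 \<and> - h r \<le> - h r\<^sub>0" for r
  proof (cases "a > 0")
    case True
    with maximum_principle[OF S True ab(2), of h] maximum_principle[OF S True ab(2), of "\<lambda>r. - h r"]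
      eq eq' show ?thesis by blast
  next
    case False
    with ab have b: "b > 0" by simp
    from maximum_principle[OF S(2,1) b ab(1), of h] maximum_principle[OF S(2,1) b ab(1), of "\<lambda>r. - h r"]
      eq eq' show ?thesis by (metis add.commute)
  qed
  then have "h r = h r\<^sub>0" for r by (simp add: antisym)
  from this[of "wr t"] this[of "br t"] show ?thesis using h[OF t] by simp
qed

end

section \<open>Parent edges in trees\<close>

lemma joined_sym: "(p, q) \<in> joined ends F \<Longrightarrow> (q, p) \<in> joined ends F"
  by (auto simp: joined_def insert_commute)

lemma joined_rtrancl_sym: "(p, q) \<in> (joined ends F)\<^sup>* \<Longrightarrow> (q, p) \<in> (joined ends F)\<^sup>*"
  by (metis joined_sym sym_rtrancl symI symD)

text \<open>\<open>\<pi> p\<close> leads from \<open>p\<close> to a point one step nearer to the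
  root. If two different points shared this edge, each would be nearer to the root than the
  other.\<close>

lemma parent_edges:
  assumes conn: "\<And>p. p \<in> U \<Longrightarrow> (\<rho>, p) \<in> (joined ends F)\<^sup>*"
    and sub: "\<And>a. a \<in> F \<Longrightarrow> ends a \<subseteq> U"
  obtains \<pi> where "inj_on \<pi> (U - {\<rho>})" "\<And>p. p \<in> U - {\<rho>} \<Longrightarrow> \<pi> p \<in> F \<and> p \<in> ends (\<pi> p)"
    "\<And>p. p \<in> U \<Longrightarrow> (\<rho>, p) \<in> (joined ends (\<pi> ` (U - {\<rho>})))\<^sup>*"
proof -
  define d where "d p = (LEAST n. (\<rho>, p) \<in> joined ends F ^^ n)" for p
  have "\<exists>a q. a \<in> F \<and> ends a = {q, p} \<and> d p = Suc (d q)" if p: "p \<in> U" "p \<noteq> \<rho>" for p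
  proof -
    have "\<exists>n. (\<rho>, p) \<in> joined ends F ^^ n" using conn[OF p(1)] by (simp add: rtrancl_power)
    then have n: "(\<rho>, p) \<in> joined ends F ^^ d p" unfolding d_def by (rule LeastI_ex)
    then obtain m where m: "d p = Suc m" using p by (cases "d p") auto
    with n obtain q where q: "(\<rho>, q) \<in> joined ends F ^^ m" "(q, p) \<in> joined ends F" by auto
    have "(\<rho>, q) \<in> joined ends F ^^ d q" unfolding d_def using q(1) by (rule LeastI)
    then have "(\<rho>, p) \<in> joined ends F ^^ Suc (d q)" using q(2) by auto
    then have "d p \<le> Suc (d q)" unfolding d_def by (rule Least_le)
    moreover have "d q \<le> m" unfolding d_def using q(1) by (rule Least_le)
    ultimately show ?thesis using q(2) m by (auto simp: joined_def)
  qed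
  then obtain \<pi> par where \<pi>: "\<And>p. p \<in> U \<Longrightarrow> p \<noteq> \<rho> \<Longrightarrow>
      \<pi> p \<in> F \<and> ends (\<pi> p) = {par p, p} \<and> d p = Suc (d (par p))"
    by metis
  show thesis
  proof
    show "inj_on \<pi> (U - {\<rho>})"
    proof (rule inj_onI)
      fix p q assume pq: "p \<in> U - {\<rho>}" "q \<in> U - {\<rho>}" "\<pi> p = \<pi> q"
      then have *: "ends (\<pi> p) = {par p, p}" "d p = Suc (d (par p))"
        "ends (\<pi> q) = {par q, q}" "d q = Suc (d (par q))" using \<pi> by blast+
      then have "p = q \<or> par p = q \<and> par q = p" using pq(3) by (metis doubleton_eq_iff)
      then show "p = q" using *(2,4) by auto
    qed
    show "\<pi> p \<in> F \<and> p \<in> ends (\<pi> p)" if "p \<in> U - {\<rho>}" for p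
      using \<pi> that by auto
    show "(\<rho>, p) \<in> (joined ends (\<pi> ` (U - {\<rho>})))\<^sup>*" if "p \<in> U" for p
      using that
    proof (induction p rule: measure_induct_rule[of d])
      case (less p)
      show ?case
      proof (cases "p = \<rho>")
        case False
        with less \<pi> have p: "\<pi> p \<in> F" "ends (\<pi> p) = {par p, p}" "d p = Suc (d (par p))" by auto
        then have "(\<rho>, par p) \<in> (joined ends (\<pi> ` (U - {\<rho>})))\<^sup>*"
          using sub by (intro less.IH) auto
        moreover have "(par p, p) \<in> joined ends (\<pi> ` (U - {\<rho>}))"
          using p False less.prems by (auto simp: joined_def)
        ultimately show ?thesis by (rule rtrancl_into_rtrancl)
      qed simp
    qed
  qed
qed

lemma simple_path:
  assumes "(p, q) \<in> (joined ends F)\<^sup>*"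
  obtains ps as where "length ps = Suc (length as)" "distinct ps" "ps ! 0 = p" "last ps = q"
    "\<And>i. i < length as \<Longrightarrow> as ! i \<in> F \<and> ends (as ! i) = {ps ! i, ps ! Suc i}"
proof -
  have "\<exists>ps as. length ps = Suc (length as) \<and> distinct ps \<and> ps ! 0 = p \<and> last ps = q \<and>
    (\<forall>i < length as. as ! i \<in> F \<and> ends (as ! i) = {ps ! i, ps ! Suc i})"
    using assms
  proof (induction rule: rtrancl_induct)
    case base
    show ?case by (intro exI[of _ "[p]"] exI[of _ "[]"]) simp
  next
    case (step y z)
    then obtain ps as where IH: "length ps = Suc (length as)" "distinct ps" "ps ! 0 = p" "last ps = y"
      "\<And>i. i < length as \<Longrightarrow> as ! i \<in> F \<and> ends (as ! i) = {ps ! i, ps ! Suc i}" by blast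
    from step(2) obtain a where a: "a \<in> F" "ends a = {y, z}" by (auto simp: joined_def)
    have last: "ps ! length as = y" using IH by (metis last_conv_nth length_0_conv diff_Suc_1 nat.simps(3))
    show ?case
    \<comment> \<open>A step to a point already visited cuts the path back to that point.\<close>
    proof (cases "z \<in> set ps")
      case True
      then obtain j where j: "j < length ps" "ps ! j = z" by (metis in_set_conv_nth)
      show ?thesis
      proof (intro exI conjI allI impI)
        show "length (take (Suc j) ps) = Suc (length (take j as))" using j IH(1) by simp
        show "last (take (Suc j) ps) = z" using j by (simp add: take_Suc_conv_app_nth)
      qed (use IH j in auto)
    next
      case False
      show ?thesis
      proof (intro exI[of _ "ps @ [z]"] exI[of _ "as @ [a]"] conjI allI impI)
        fix i assume i: "i < length (as @ [a])"
        show "(as @ [a]) ! i \<in> F" using i IH a by (auto simp: nth_append)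
        show "ends ((as @ [a]) ! i) = {(ps @ [z]) ! i, (ps @ [z]) ! Suc i}"
          using i IH a last by (auto simp: nth_append less_Suc_eq)
      qed (use IH False in \<open>auto simp: nth_append\<close>)
    qed
  qed
  then show thesis using that by blast
qed

lemma cycle_from_path:
  assumes "(p, q) \<in> (joined ends F)\<^sup>*" "p \<noteq> q" "a \<notin> F" "ends a = {p, q}"
  obtains ps as where "is_cycle ends ps as" "set as \<subseteq> insert a F"
proof -
  obtain ps as where path: "length ps = Suc (length as)" "distinct ps" "ps ! 0 = p" "last ps = q"
    "\<And>i. i < length as \<Longrightarrow> as ! i \<in> F \<and> ends (as ! i) = {ps ! i, ps ! Suc i}"
    using simple_path[OF assms(1)] by blast
  have last: "ps ! length as = q" using path by (metis last_conv_nth length_0_conv diff_Suc_1 nat.simps(3))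
  have "i = j" if ij: "i < length as" "j < length as" "as ! i = as ! j" for i j
  proof -
    have "{ps ! i, ps ! Suc i} = {ps ! j, ps ! Suc j}" using path(5) ij by metis
    then have "ps ! i = ps ! j \<or> ps ! i = ps ! Suc j \<and> ps ! Suc i = ps ! j" by (metis doubleton_eq_iff)
    then show ?thesis using path(1,2) ij by (auto simp: nth_eq_iff_index_eq)
  qed
  then have dist: "distinct as" by (auto simp: distinct_conv_nth)
  have "is_cycle ends ps (as @ [a])"
    unfolding is_cycle_def
  proof (intro conjI allI impI)
    have "set as \<subseteq> F" using path(5) by (auto simp: in_set_conv_nth)
    then show "distinct (as @ [a])" using dist assms(3) by auto
    fix i assume "i < length (as @ [a])"
    then consider "i < length as" | "i = length as" by fastforce
    then show "ends ((as @ [a]) ! i) = {ps ! i, ps ! (Suc i mod length (as @ [a]))}"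
      by cases (use path last assms(4) in \<open>auto simp: nth_append\<close>)
  qed (use path in auto)
  moreover have "set (as @ [a]) \<subseteq> insert a F" using path(5) by (auto simp: in_set_conv_nth)
  ultimately show thesis by (rule that)
qed

lemma card_connected_ge:
  assumes "\<rho> \<in> U" "finite U" "finite F" "\<And>p. p \<in> U \<Longrightarrow> (\<rho>, p) \<in> (joined ends F)\<^sup>*"
    and "\<And>a. a \<in> F \<Longrightarrow> ends a \<subseteq> U"
  shows "card U \<le> card F + 1"
proof -
  obtain \<pi> where \<pi>: "inj_on \<pi> (U - {\<rho>})" "\<And>p. p \<in> U - {\<rho>} \<Longrightarrow> \<pi> p \<in> F \<and> p \<in> ends (\<pi> p)"
    using parent_edges[OF assms(4,5)] by metis
  have "card (U - {\<rho>}) \<le> card F"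
    by (rule card_inj_on_le[OF \<pi>(1)]) (use \<pi>(2) assms(3) in auto)
  then show ?thesis using assms(1,2) by simp
qed

text \<open>The parent edges connect all points, so any further edge would close a cycle.\<close>

lemma is_tree_parent_edges:
  assumes tree: "is_tree ends U F" and \<rho>: "\<rho> \<in> U" and two: "\<And>a. a \<in> F \<Longrightarrow> card (ends a) = 2"
  obtains \<pi> where "bij_betw \<pi> (U - {\<rho>}) F" "\<And>p. p \<in> U - {\<rho>} \<Longrightarrow> p \<in> ends (\<pi> p)"
proof -
  have conn: "(p, q) \<in> (joined ends F)\<^sup>*" if "p \<in> U" "q \<in> U" for p q
    using tree that by (auto simp: is_tree_def)
  have sub: "ends a \<subseteq> U" if "a \<in> F" for a using tree that by (auto simp: is_tree_def)
  obtain \<pi> where \<pi>: "inj_on \<pi> (U - {\<rho>})" "\<And>p. p \<in> U - {\<rho>} \<Longrightarrow> \<pi> p \<in> F \<and> p \<in> ends (\<pi> p)"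
    "\<And>p. p \<in> U \<Longrightarrow> (\<rho>, p) \<in> (joined ends (\<pi> ` (U - {\<rho>})))\<^sup>*"
    using parent_edges[of U \<rho> ends F, OF conn[OF \<rho>] sub] by blast
  have "F \<subseteq> \<pi> ` (U - {\<rho>})"
  proof (rule ccontr)
    assume "\<not> F \<subseteq> \<pi> ` (U - {\<rho>})"
    then obtain a where a: "a \<in> F" "a \<notin> \<pi> ` (U - {\<rho>})" by blast
    then obtain p q where pq: "ends a = {p, q}" "p \<noteq> q" using two[OF a(1)] by (auto simp: card_2_iff)
    then have "(p, q) \<in> (joined ends (\<pi> ` (U - {\<rho>})))\<^sup>*"
      using \<pi>(3)[of p] \<pi>(3)[of q] sub[OF a(1)] joined_rtrancl_sym[of \<rho> p] by (auto intro: rtrancl_trans)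
    then obtain ps as where "is_cycle ends ps as" "set as \<subseteq> insert a (\<pi> ` (U - {\<rho>}))"
      using cycle_from_path[where p = p and q = q and a = a and ends = ends and F = "\<pi> ` (U - {\<rho>})"] pq a(2)
      by blast
    moreover have "insert a (\<pi> ` (U - {\<rho>})) \<subseteq> F" using a \<pi>(2) by auto
    ultimately have "is_cycle ends ps as \<and> set as \<subseteq> F" by blast
    then show False using tree unfolding is_tree_def by blast
  qed
  with \<pi> show thesis by (intro that[of \<pi>]) (auto simp: bij_betw_def)
qed

text \<open>Deleting one edge of a cycle keeps the graph connected, but leaves fewer edges than
  connectedness requires.\<close>

lemma is_treeI_card:
  assumes "U \<noteq> {}" "finite U" "finite F" and sub: "\<And>a. a \<in> F \<Longrightarrow> ends a \<subseteq> U"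
    and conn: "\<And>p q. p \<in> U \<Longrightarrow> q \<in> U \<Longrightarrow> (p, q) \<in> (joined ends F)\<^sup>*"
    and card: "card F + 1 = card U"
  shows "is_tree ends U F"
  unfolding is_tree_def
proof (intro conjI notI)
  assume "\<exists>ps as. is_cycle ends ps as \<and> set as \<subseteq> F"
  then obtain ps as where cyc: "as \<noteq> []" "length ps = length as" "distinct as" "set as \<subseteq> F"
    "\<And>i. i < length as \<Longrightarrow> ends (as ! i) = {ps ! i, ps ! (Suc i mod length as)}"
    by (auto simp: is_cycle_def)
  define G where "G = F - {last as}"
  have last: "last as \<in> F" using cyc by auto
  have path: "(ps ! 0, ps ! i) \<in> (joined ends G)\<^sup>*" if "i < length as" for i
    using that
  proof (induction i)
    case (Suc i)
    have "as ! i \<noteq> last as"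
      using Suc.prems cyc(1,3) by (metis Suc_lessD diff_Suc_1 last_conv_nth length_greater_0_conv less_irrefl
          lessI nth_eq_iff_index_eq Suc_pred)
    then have "as ! i \<in> G" using Suc.prems cyc(4) by (auto simp: G_def)
    then have "(ps ! i, ps ! Suc i) \<in> joined ends G"
      using cyc(5)[of i] Suc.prems by (auto simp: joined_def)
    with Suc show ?case by (auto intro: rtrancl_into_rtrancl)
  qed simp
  define n where "n = length as - 1"
  have n: "n < length as" "last as = as ! n" "Suc n mod length as = 0"
    using cyc(1) by (simp_all add: n_def last_conv_nth)
  have "ends (last as) = {ps ! n, ps ! 0}" using cyc(5)[OF n(1)] n by simp
  moreover have "(ps ! 0, ps ! n) \<in> (joined ends G)\<^sup>*" by (rule path[OF n(1)])
  ultimately have closing: "(p, q) \<in> (joined ends G)\<^sup>*" if "ends (last as) = {p, q}" for p q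
    using that joined_rtrancl_sym[of "ps ! 0" "ps ! n"] by (auto simp: doubleton_eq_iff)
  have "joined ends F \<subseteq> (joined ends G)\<^sup>*"
  proof (clarsimp simp: joined_def[of ends F])
    fix p q a assume a: "a \<in> F" "ends a = {p, q}"
    show "(p, q) \<in> (joined ends G)\<^sup>*"
    proof (cases "a = last as")
      case False
      then have "(p, q) \<in> joined ends G" using a by (auto simp: joined_def G_def)
      then show ?thesis by (rule r_into_rtrancl)
    qed (use a closing in simp)
  qed
  then have "(joined ends F)\<^sup>* \<subseteq> (joined ends G)\<^sup>*" by (rule rtrancl_subset_rtrancl)
  moreover obtain \<rho> where "\<rho> \<in> U" using assms(1) by blast
  ultimately have "card U \<le> card G + 1"
    using assms(2,3) conn sub by (intro card_connected_ge[of \<rho>]) (auto simp: G_def dest: subsetD[OF sub])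
  moreover have "card G < card F" unfolding G_def using last assms(3) by (intro psubset_card_mono) auto
  ultimately show False using card by linarith
qed (use assms in auto)

context planar_web
begin

text \<open>
  Rooting the tree at \<open>e\<^sub>1\<close> and letting each violet point be supplied along its parent edge gives the
  supplies \<open>f\<close>, plus one unit at \<open>e\<^sub>1\<close>. The flow is the average over all \<open>e\<^sub>1\<close>.
\<close>

lemma tree_flow:
  assumes T: "T \<subseteq> W" and deg: "\<And>e. card {t \<in> T. eo t = e} = f e + 1"
    and parents: "\<And>e\<^sub>1. \<exists>\<alpha> \<beta>. (\<forall>e. e \<noteq> e\<^sub>1 \<longrightarrow> \<alpha> e \<in> T \<and> eo (\<alpha> e) = e) \<and> (\<forall>v. \<beta> v \<in> T \<and> vi (\<beta> v) = v) \<and>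
      (\<forall>e v. e \<noteq> e\<^sub>1 \<longrightarrow> \<alpha> e \<noteq> \<beta> v) \<and> T \<subseteq> \<alpha> ` (- {e\<^sub>1}) \<union> range \<beta>"
  obtains x where "\<And>t. t \<in> W \<Longrightarrow> 0 \<le> x t"
    "\<And>e. (\<Sum>t\<in>{t\<in>W. eo t = e}. x t) = real (f e) + 1 / CARD('e)"
    "\<And>v. (\<Sum>t\<in>{t\<in>W. vi t = v}. x t) = 1"
proof -
  from parents obtain \<alpha> \<beta> where
    \<alpha>: "\<And>e\<^sub>1 e. e \<noteq> e\<^sub>1 \<Longrightarrow> \<alpha> e\<^sub>1 e \<in> T \<and> eo (\<alpha> e\<^sub>1 e) = e" and
    \<beta>: "\<And>e\<^sub>1 v. \<beta> e\<^sub>1 v \<in> T \<and> vi (\<beta> e\<^sub>1 v) = v" and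
    disj: "\<And>e\<^sub>1 e v. e \<noteq> e\<^sub>1 \<Longrightarrow> \<alpha> e\<^sub>1 e \<noteq> \<beta> e\<^sub>1 v" and
    cover: "\<And>e\<^sub>1. T \<subseteq> \<alpha> e\<^sub>1 ` (- {e\<^sub>1}) \<union> range (\<beta> e\<^sub>1)"
    by metis
  define y where "y e\<^sub>1 t = (of_bool (t \<in> range (\<beta> e\<^sub>1)) :: real)" for e\<^sub>1 t
  have yv: "(\<Sum>t\<in>{t\<in>W. vi t = v}. y e\<^sub>1 t) = 1" for e\<^sub>1 v
  proof -
    have "{t\<in>W. vi t = v} \<inter> range (\<beta> e\<^sub>1) = {\<beta> e\<^sub>1 v}" using \<beta> T by fastforce
    then show ?thesis by (simp add: y_def)
  qed
  \<comment> \<open>Of the \<open>f e + 1\<close> tree edges at \<open>e\<close>, one is the parent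
    edge of \<open>e\<close> itself unless \<open>e\<close> is the root; the others are parent edges
    of violet points and carry one unit each.\<close>
  have ye: "(\<Sum>t\<in>{t\<in>W. eo t = e}. y e\<^sub>1 t) = real (f e) + of_bool (e = e\<^sub>1)" for e\<^sub>1 e
  proof -
    let ?B = "{t\<in>W. eo t = e} \<inter> range (\<beta> e\<^sub>1)"
    have sub: "?B \<subseteq> {t\<in>T. eo t = e}" using \<beta> by auto
    have "card {t\<in>T. eo t = e} = card ?B + of_bool (e \<noteq> e\<^sub>1)"
    proof (cases "e = e\<^sub>1")
      case True
      have "{t\<in>T. eo t = e} \<subseteq> ?B"
      proof
        fix t assume t: "t \<in> {t\<in>T. eo t = e}"
        then consider e' where "t = \<alpha> e\<^sub>1 e'" "e' \<noteq> e\<^sub>1" | "t \<in> range (\<beta> e\<^sub>1)" using cover[of e\<^sub>1] by blast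
        then show "t \<in> ?B" by cases (use t \<alpha> True T in auto)
      qed
      with sub have "{t\<in>T. eo t = e} = ?B" by blast
      with True show ?thesis by simp
    next
      case False
      have "{t\<in>T. eo t = e} \<subseteq> insert (\<alpha> e\<^sub>1 e) ?B"
      proof
        fix t assume t: "t \<in> {t\<in>T. eo t = e}"
        then consider e' where "t = \<alpha> e\<^sub>1 e'" "e' \<noteq> e\<^sub>1" | "t \<in> range (\<beta> e\<^sub>1)" using cover[of e\<^sub>1] by blast
        then show "t \<in> insert (\<alpha> e\<^sub>1 e) ?B" by cases (use t \<alpha> T in auto)
      qed
      with sub have "{t\<in>T. eo t = e} = insert (\<alpha> e\<^sub>1 e) ?B" using \<alpha>[OF False] by blast
      moreover have "\<alpha> e\<^sub>1 e \<notin> ?B" using disj[OF False] by blast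
      ultimately show ?thesis using False by simp
    qed
    then have "f e + 1 = card ?B + of_bool (e \<noteq> e\<^sub>1)" using deg[of e] by simp
    then show ?thesis by (cases "e = e\<^sub>1") (auto simp: y_def)
  qed
  show thesis
  proof (rule that[of "\<lambda>t. (\<Sum>e\<^sub>1\<in>UNIV. y e\<^sub>1 t) / CARD('e)"])
    fix t show "0 \<le> (\<Sum>e\<^sub>1\<in>UNIV. y e\<^sub>1 t) / CARD('e)"
      by (intro divide_nonneg_nonneg sum_nonneg) (simp_all add: y_def)
  next
    fix e
    have "(\<Sum>t\<in>{t\<in>W. eo t = e}. \<Sum>e\<^sub>1\<in>UNIV. y e\<^sub>1 t) = CARD('e) * f e + 1"
      by (subst sum.swap) (simp add: ye sum.distrib)
    then show "(\<Sum>t\<in>{t\<in>W. eo t = e}. (\<Sum>e\<^sub>1\<in>UNIV. y e\<^sub>1 t) / CARD('e)) = real (f e) + 1 / CARD('e)"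
      by (simp add: sum_divide_distrib[symmetric] field_simps)
  next
    fix v
    have "(\<Sum>t\<in>{t\<in>W. vi t = v}. \<Sum>e\<^sub>1\<in>UNIV. y e\<^sub>1 t) = CARD('e)"
      by (subst sum.swap) (simp add: yv)
    then show "(\<Sum>t\<in>{t\<in>W. vi t = v}. (\<Sum>e\<^sub>1\<in>UNIV. y e\<^sub>1 t) / CARD('e)) = 1"
      by (simp add: sum_divide_distrib[symmetric])
  qed
qed

end

section \<open>The red graph of a trinity\<close>

lemma UNIV_colour: "UNIV = {Red, Emerald, Violet}"
  by (rule UNIV_eq_I) (metis colour.exhaust insertCI)

instance colour :: finite
proof
  show "finite (UNIV :: colour set)" unfolding UNIV_colour by simp
qed

lemma card_UNIV_point:
  "CARD(('r::finite, 'e::finite, 'v::finite) point) = CARD('r) + CARD('e) + CARD('v)"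
proof -
  have "(UNIV :: ('r, 'e, 'v) point set) = (range RedPt \<union> range EmeraldPt) \<union> range VioletPt"
    by (rule UNIV_eq_I) (metis point.exhaust UnCI rangeI)
  also have "card \<dots> = card (range RedPt \<union> range EmeraldPt :: ('r, 'e, 'v) point set) + card (range VioletPt :: ('r, 'e, 'v) point set)"
    by (rule card_Un_disjoint) auto
  also have "card (range RedPt \<union> range EmeraldPt :: ('r, 'e, 'v) point set) =
      card (range RedPt :: ('r, 'e, 'v) point set) + card (range EmeraldPt :: ('r, 'e, 'v) point set)"
    by (rule card_Un_disjoint) auto
  finally show ?thesis by (simp add: card_image inj_on_def)
qed

context oriented_sphere_triangulation
begin

text \<open>The three sides have different pairs of ends, and three corners form only three pairs,
  so every pair occurs.\<close>

lemma side_between: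
  assumes "p \<in> corners ends sides t" "q \<in> corners ends sides t" "p \<noteq> q"
  obtains a where "a \<in> sides t" "ends a = {p, q}"
proof -
  let ?C = "corners ends sides t"
  have "ends ` sides t \<subseteq> {P. P \<subseteq> ?C \<and> card P = 2}" using ends by (auto simp: corners_def)
  moreover have "card {P. P \<subseteq> ?C \<and> card P = 2} = card (ends ` sides t)"
    using n_subsets[of ?C 2] corners[of t] sides[of t] by (simp add: card_image choose_two)
  ultimately have "ends ` sides t = {P. P \<subseteq> ?C \<and> card P = 2}"
    by (metis card_subset_eq finite)
  moreover have "{p, q} \<in> {P. P \<subseteq> ?C \<and> card P = 2}" using assms by simp
  ultimately show thesis using that by (metis imageE)
qed

text \<open>All triangles are connected through common sides: \<open>link\<close> leads around a
  point, and a triangle at an edge leads from one end of the edge to the other. Connectedness is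
  phrased through functions because the axioms of \<open>planar_web\<close> have this form.\<close>

lemma adjacent_constant:
  assumes adj: "\<And>s t a. a \<in> sides s \<Longrightarrow> a \<in> sides t \<Longrightarrow> H s = H t"
  shows "H s = H t"
proof -
  have around: "H s = H t" if "p \<in> corners ends sides s" "p \<in> corners ends sides t" for p s t
    using link[OF that]
  proof (induction rule: rtrancl_induct)
    case (step y z)
    then obtain a where "a \<in> sides y" "a \<in> sides z" by blast
    then show ?case using adj step.IH by metis
  qed simp
  have "\<forall>t. q \<in> corners ends sides t \<longrightarrow> H s = H t"
    if "(p, q) \<in> (joined ends UNIV)\<^sup>*" "p \<in> corners ends sides s" for p q
    using that
  proof (induction rule: rtrancl_induct)
    case base
    then show ?case using around by blast
  next
    case (step y z)
    from step(2) obtain a where a: "ends a = {y, z}" by (auto simp: joined_def)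
    obtain u where "a \<in> sides u" using two_triangles[of a] by (metis (mono_tags, lifting) Collect_empty_eq card.empty zero_neq_numeral)
    then have "y \<in> corners ends sides u" "z \<in> corners ends sides u" using a by (auto simp: corners_def)
    with step show ?case using around by metis
  qed
  note path = this
  have "corners ends sides u \<noteq> {}" for u using corners[of u] by auto
  then obtain p q where "p \<in> corners ends sides s" "q \<in> corners ends sides t" by blast
  then show ?thesis using path connected by blast
qed

end

context trinity
begin

section \<open>Corners and sides by colour\<close>

text \<open>This is the side opposite to the corner of colour \<open>c\<close>, hence the one whose
  edge colour is \<open>c\<close>.\<close>

definition side :: "'t \<Rightarrow> colour \<Rightarrow> 'a" where
  "side t c = (THE a. a \<in> sides t \<and> ends a = {p \<in> corners ends sides t. colour_of p \<noteq> c})"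

definition red_corner :: "'t \<Rightarrow> 'r" where
  "red_corner t = (THE r. RedPt r \<in> corners ends sides t)"

definition violet_corner :: "'t \<Rightarrow> 'v" where
  "violet_corner t = (THE v. VioletPt v \<in> corners ends sides t)"

abbreviation em :: "'t \<Rightarrow> 'e" where
  "em \<equiv> emerald_corner ends sides"

text \<open>Any two corners are joined by a side and so differ in colour; three corners thus take
  each of the three colours once.\<close>

lemma corners_eq: "corners ends sides t = {RedPt (red_corner t), EmeraldPt (em t), VioletPt (violet_corner t)}"
proof -
  let ?C = "corners ends sides t"
  have inj: "inj_on colour_of ?C"
  proof (rule inj_onI, rule ccontr)
    fix p q assume pq: "p \<in> ?C" "q \<in> ?C" "colour_of p = colour_of q" "p \<noteq> q"
    then obtain a where "a \<in> sides t" "ends a = {p, q}" using side_between by blast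
    then show False using proper[of a] pq by (auto simp: inj_on_def)
  qed
  then have "card (colour_of ` ?C) = card (UNIV :: colour set)"
    using corners[of t] by (simp add: card_image UNIV_colour)
  then have im: "colour_of ` ?C = UNIV" by (metis card_subset_eq finite subset_UNIV)
  have ex: "\<exists>p\<in>?C. colour_of p = c" for c using im by (metis UNIV_I imageE)
  obtain r where r: "RedPt r \<in> ?C" using ex[of Red] by (blast elim: colour_of.elims)
  obtain e where e: "EmeraldPt e \<in> ?C" using ex[of Emerald] by (blast elim: colour_of.elims)
  obtain v where v: "VioletPt v \<in> ?C" using ex[of Violet] by (blast elim: colour_of.elims)
  have uniq: "p = q" if "p \<in> ?C" "q \<in> ?C" "colour_of p = colour_of q" for p q
    using inj that by (auto dest: inj_onD)
  have "red_corner t = r" unfolding red_corner_def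
    by (rule the_equality) (use r uniq[of _ "RedPt r"] in fastforce)+
  moreover have "em t = e" unfolding emerald_corner_def
    by (rule the_equality) (use e uniq[of _ "EmeraldPt e"] in fastforce)+
  moreover have "violet_corner t = v" unfolding violet_corner_def
    by (rule the_equality) (use v uniq[of _ "VioletPt v"] in fastforce)+
  moreover have "{RedPt r, EmeraldPt e, VioletPt v} = ?C"
    by (rule card_subset_eq) (use r e v corners[of t] in auto)
  ultimately show ?thesis by simp
qed

lemma corners_other_colours:
  "{p \<in> corners ends sides t. colour_of p \<noteq> Red} = {EmeraldPt (em t), VioletPt (violet_corner t)}"
  "{p \<in> corners ends sides t. colour_of p \<noteq> Emerald} = {RedPt (red_corner t), VioletPt (violet_corner t)}"
  "{p \<in> corners ends sides t. colour_of p \<noteq> Violet} = {RedPt (red_corner t), EmeraldPt (em t)}"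
  by (auto simp: corners_eq)

lemma side: "side t c \<in> sides t" "ends (side t c) = {p \<in> corners ends sides t. colour_of p \<noteq> c}"
proof -
  have between: "\<exists>a. a \<in> sides t \<and> ends a = {p, q}" if "{p, q} \<subseteq> corners ends sides t" "p \<noteq> q" for p q
    using that side_between[of p t q] by blast
  have "\<exists>a. a \<in> sides t \<and> ends a = {p \<in> corners ends sides t. colour_of p \<noteq> c}"
  proof (cases c)
    case Red
    show ?thesis unfolding Red corners_other_colours by (rule between) (simp_all add: corners_eq)
  next
    case Emerald
    show ?thesis unfolding Emerald corners_other_colours by (rule between) (simp_all add: corners_eq)
  next
    case Violet
    show ?thesis unfolding Violet corners_other_colours by (rule between) (simp_all add: corners_eq)
  qed
  then obtain a where "a \<in> sides t" "ends a = {p \<in> corners ends sides t. colour_of p \<noteq> c}" by blast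
  moreover from this have "b = a" if "b \<in> sides t" "ends b = {p \<in> corners ends sides t. colour_of p \<noteq> c}" for b
    using that sides(2)[of t] unfolding inj_on_def by metis
  ultimately have "side t c = a" unfolding side_def by (intro the_equality) blast+
  with \<open>a \<in> sides t\<close> \<open>ends a = _\<close> show "side t c \<in> sides t" "ends (side t c) = {p \<in> corners ends sides t. colour_of p \<noteq> c}" by auto
qed

lemma ends_side:
  "ends (side t Red) = {EmeraldPt (em t), VioletPt (violet_corner t)}"
  "ends (side t Emerald) = {RedPt (red_corner t), VioletPt (violet_corner t)}"
  "ends (side t Violet) = {RedPt (red_corner t), EmeraldPt (em t)}"
  by (simp_all only: side(2) corners_other_colours)

lemma edge_colour_side: "edge_colour ends (side t c) = c"
proof -
  have "colour_of ` ends (side t c) = - {c}"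
    by (cases c) (auto simp: ends_side Compl_eq_Diff_UNIV UNIV_colour)
  then show ?thesis by (simp add: edge_colour_def)
qed

lemma sides_eq: "sides t = range (side t)"
proof (rule sym, rule card_subset_eq)
  have "inj (side t)" by (metis edge_colour_side injI)
  then show "card (range (side t)) = card (sides t)" using sides(1)[of t] by (simp add: card_image UNIV_colour)
qed (use side in auto)

lemma side_edge_colour: "a \<in> sides t \<Longrightarrow> side t (edge_colour ends a) = a"
  by (auto simp: sides_eq edge_colour_side)

lemma ori_white:
  "t \<in> white ori \<Longrightarrow> ori t = {(RedPt (red_corner t), EmeraldPt (em t)),
    (EmeraldPt (em t), VioletPt (violet_corner t)), (VioletPt (violet_corner t), RedPt (red_corner t))}"
  and ori_black:
  "t \<notin> white ori \<Longrightarrow> ori t = {(EmeraldPt (em t), RedPt (red_corner t)),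
    (VioletPt (violet_corner t), EmeraldPt (em t)), (RedPt (red_corner t), VioletPt (violet_corner t))}"
proof -
  define r e v where "r = red_corner t" and "e = em t" and "v = violet_corner t"
  have C: "corners ends sides t = {RedPt r, EmeraldPt e, VioletPt v}"
    by (simp add: corners_eq r_def e_def v_def)
  obtain x y z where xyz: "corners ends sides t = {x, y, z}" "ori t = {(x, y), (y, z), (z, x)}"
    using cyclic[of t] by blast
  have dist: "x \<noteq> y" "y \<noteq> z" "x \<noteq> z" using corners[of t] unfolding xyz(1) by (auto simp: card_insert_if split: if_splits)
  have "x \<in> {RedPt r, EmeraldPt e, VioletPt v}" "y \<in> {RedPt r, EmeraldPt e, VioletPt v}"
    "z \<in> {RedPt r, EmeraldPt e, VioletPt v}" using C xyz(1) by blast+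
  then have "(x, y, z) \<in> {(RedPt r, EmeraldPt e, VioletPt v), (EmeraldPt e, VioletPt v, RedPt r),
      (VioletPt v, RedPt r, EmeraldPt e), (EmeraldPt e, RedPt r, VioletPt v),
      (RedPt r, VioletPt v, EmeraldPt e), (VioletPt v, EmeraldPt e, RedPt r)}"
    using dist by (elim insertE emptyE) simp_all
  then consider (W) "ori t = {(RedPt r, EmeraldPt e), (EmeraldPt e, VioletPt v), (VioletPt v, RedPt r)}"
    | (B) "ori t = {(EmeraldPt e, RedPt r), (VioletPt v, EmeraldPt e), (RedPt r, VioletPt v)}"
    unfolding xyz(2) by (elim insertE emptyE) (simp_all add: insert_commute)
  then have "t \<in> white ori \<and> ori t = {(RedPt r, EmeraldPt e), (EmeraldPt e, VioletPt v), (VioletPt v, RedPt r)} \<or>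
      t \<notin> white ori \<and> ori t = {(EmeraldPt e, RedPt r), (VioletPt v, EmeraldPt e), (RedPt r, VioletPt v)}"
    by cases (simp_all add: white_def)
  then show "t \<in> white ori \<Longrightarrow> ori t = {(RedPt (red_corner t), EmeraldPt (em t)),
    (EmeraldPt (em t), VioletPt (violet_corner t)), (VioletPt (violet_corner t), RedPt (red_corner t))}"
    "t \<notin> white ori \<Longrightarrow> ori t = {(EmeraldPt (em t), RedPt (red_corner t)),
    (VioletPt (violet_corner t), EmeraldPt (em t)), (RedPt (red_corner t), VioletPt (violet_corner t))}"
    unfolding r_def e_def v_def by blast+
qed

text \<open>A white triangle runs along each of its sides in the cyclic direction red, emerald,
  violet, and a black one against it. Coherence demands opposite directions on a common
  side.\<close>

lemma white_alternates:
  assumes "a \<in> sides s" "a \<in> sides t" "s \<noteq> t"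
  shows "s \<in> white ori \<longleftrightarrow> t \<notin> white ori"
proof -
  define c where "c = edge_colour ends a"
  have a: "side s c = a" "side t c = a" using assms by (simp_all add: c_def side_edge_colour)
  have coh: "(p, q) \<in> ori s \<longleftrightarrow> (p, q) \<notin> ori t" if "ends a = {p, q}" for p q
    using coherent assms that by blast
  have eq: "ends a = ends (side s c)" "ends a = ends (side t c)" using a by simp_all
  have W: "(EmeraldPt (em u), VioletPt (violet_corner u)) \<in> ori u \<longleftrightarrow> u \<in> white ori"
    "(VioletPt (violet_corner u), RedPt (red_corner u)) \<in> ori u \<longleftrightarrow> u \<in> white ori"
    "(RedPt (red_corner u), EmeraldPt (em u)) \<in> ori u \<longleftrightarrow> u \<in> white ori" for u
    using ori_white[of u] ori_black[of u] by (cases "u \<in> white ori"; simp)+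
  show ?thesis
  proof (cases c)
    case Red
    then have "em s = em t" "violet_corner s = violet_corner t"
      "ends a = {EmeraldPt (em s), VioletPt (violet_corner s)}"
      using eq by (simp_all add: ends_side doubleton_eq_iff)
    with coh W(1)[of s] W(1)[of t] show ?thesis by metis
  next
    case Emerald
    then have "red_corner s = red_corner t" "violet_corner s = violet_corner t"
      "ends a = {VioletPt (violet_corner s), RedPt (red_corner s)}"
      using eq by (simp_all add: ends_side doubleton_eq_iff)
    with coh W(2)[of s] W(2)[of t] show ?thesis by metis
  next
    case Violet
    then have "red_corner s = red_corner t" "em s = em t"
      "ends a = {RedPt (red_corner s), EmeraldPt (em s)}"
      using eq by (simp_all add: ends_side doubleton_eq_iff)
    with coh W(3)[of s] W(3)[of t] show ?thesis by metis
  qed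
qed

text \<open>Each edge lies on one white and one black triangle. This is what allows either kind of
  triangle to index the edges of each constituent graph.\<close>

lemma bij_betw_side:
  "bij_betw (\<lambda>t. side t c) (white ori) (graph_edges ends c)"
  "bij_betw (\<lambda>t. side t c) (- white ori) (graph_edges ends c)"
proof -
  have two: "\<exists>s t. s \<in> white ori \<and> t \<notin> white ori \<and> a \<in> sides s \<and> a \<in> sides t" for a
  proof -
    obtain s t where "{t. a \<in> sides t} = {s, t}" "s \<noteq> t" using two_triangles[of a] by (auto simp: card_2_iff)
    then show ?thesis using white_alternates[of a s t] by blast
  qed
  have onto: "\<exists>t\<in>X. side t c = a" if "a \<in> graph_edges ends c" "X = white ori \<or> X = - white ori" for a X
    using two[of a] that side_edge_colour by (auto simp: graph_edges_def)
  have "bij_betw (\<lambda>t. side t c) X (graph_edges ends c)" if X: "X = white ori \<or> X = - white ori" for X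
  proof (rule bij_betw_imageI)
    show "inj_on (\<lambda>t. side t c) X"
    proof (rule inj_onI)
      fix s t assume st: "s \<in> X" "t \<in> X" "side s c = side t c"
      then have "side t c \<in> sides s" "side t c \<in> sides t" by (metis side(1))+
      then show "s = t" using white_alternates[of "side t c" s t] st X by blast
    qed
    show "(\<lambda>t. side t c) ` X = graph_edges ends c"
    proof
      show "(\<lambda>t. side t c) ` X \<subseteq> graph_edges ends c" by (auto simp: graph_edges_def edge_colour_side)
      show "graph_edges ends c \<subseteq> (\<lambda>t. side t c) ` X" using onto X by blast
    qed
  qed
  then show "bij_betw (\<lambda>t. side t c) (white ori) (graph_edges ends c)"
    "bij_betw (\<lambda>t. side t c) (- white ori) (graph_edges ends c)" by blast+
qed

section \<open>Crossing from white to black triangles\<close>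

text \<open>For white \<open>t\<close>, this is the black triangle across the side of colour
  \<open>c\<close>.\<close>

definition mate :: "colour \<Rightarrow> 't \<Rightarrow> 't" where
  "mate c t = inv_into (- white ori) (\<lambda>s. side s c) (side t c)"

lemma bij_betw_mate: "bij_betw (mate c) (white ori) (- white ori)"
  using bij_betw_trans[OF bij_betw_side(1) bij_betw_inv_into[OF bij_betw_side(2)]]
  by (simp add: mate_def[abs_def] comp_def)

lemma side_mate: "side (mate c t) c = side t c"
proof -
  have "side t c \<in> graph_edges ends c" by (simp add: graph_edges_def edge_colour_side)
  from bij_betw_inv_into_right[OF bij_betw_side(2) this] show ?thesis by (simp add: mate_def)
qed

lemma corners_mate:
  "em (mate Red t) = em t" "violet_corner (mate Red t) = violet_corner t"
  "red_corner (mate Emerald t) = red_corner t" "violet_corner (mate Emerald t) = violet_corner t"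
  "red_corner (mate Violet t) = red_corner t" "em (mate Violet t) = em t"
proof -
  have "ends (side (mate c t) c) = ends (side t c)" for c by (simp add: side_mate)
  from this[of Red] this[of Emerald] this[of Violet]
  show "em (mate Red t) = em t" "violet_corner (mate Red t) = violet_corner t"
    "red_corner (mate Emerald t) = red_corner t" "violet_corner (mate Emerald t) = violet_corner t"
    "red_corner (mate Violet t) = red_corner t" "em (mate Violet t) = em t"
    by (simp_all add: ends_side doubleton_eq_iff)
qed

definition red_opposite :: "'t \<Rightarrow> 'r" where
  "red_opposite t = red_corner (mate Red t)"

lemma card_white_mate:
  assumes "\<And>t. P (mate c t) \<longleftrightarrow> Q t"
  shows "card {t \<in> white ori. Q t} = card {t \<in> - white ori. P t}"
proof -
  have "{t \<in> mate c ` white ori. P t} = mate c ` {t \<in> white ori. Q t}" using assms by blast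
  then have "{t \<in> - white ori. P t} = mate c ` {t \<in> white ori. Q t}"
    by (simp only: bij_betw_imp_surj_on[OF bij_betw_mate])
  moreover have "inj_on (mate c) {t \<in> white ori. Q t}"
    using bij_betw_imp_inj_on[OF bij_betw_mate] by (rule inj_on_subset) blast
  ultimately show ?thesis by (simp add: card_image)
qed

text \<open>With w white triangles there are 3w edges, w of each colour, and 2w triangles, so
  Euler's formula gives w + 2 points.\<close>

lemma card_white: "card (white ori) + 2 = CARD('r) + CARD('e) + CARD('v)"
proof -
  have "CARD('a) = (\<Sum>a\<in>(UNIV :: 'a set). 1)" by (rule card_eq_sum)
  also have "\<dots> = (\<Sum>c\<in>(UNIV :: colour set). \<Sum>a\<in>{a\<in>UNIV. edge_colour ends a = c}. 1)"
    by (rule sum.group[symmetric]) auto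
  also have "\<dots> = (\<Sum>c\<in>(UNIV :: colour set). card (white ori))"
  proof (rule sum.cong)
    fix c :: colour
    show "(\<Sum>a\<in>{a\<in>UNIV. edge_colour ends a = c}. 1) = card (white ori)"
      using bij_betw_same_card[OF bij_betw_side(1)[of c]] by (simp add: graph_edges_def)
  qed simp
  finally have "CARD('a) = 3 * card (white ori)" by (simp add: UNIV_colour)
  moreover have "CARD('t) = 2 * card (white ori)"
    using bij_betw_same_card[OF bij_betw_mate[of Red]] card_Un_disjoint[of "white ori" "- white ori"]
    by simp
  ultimately show ?thesis using euler card_UNIV_point[where 'r = 'r and 'e = 'e and 'v = 'v] by linarith
qed

lemma mate_eqI:
  assumes "side s c = side t c" "s \<in> white ori" "t \<notin> white ori"
  shows "t = mate c s"
  using inv_into_f_f[OF bij_betw_imp_inj_on[OF bij_betw_side(2)], of t c] assms by (simp add: mate_def)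

text \<open>Crossing an emerald or violet side keeps the red corner. Only crossing a red side can
  change it, and then it passes between \<open>red_corner\<close> and \<open>red_opposite\<close> of
  the white triangle.\<close>

lemma adjacent_cases:
  assumes "a \<in> sides s" "a \<in> sides t" "s \<noteq> t"
  obtains "side s Red = side t Red" "em s = em t" "s \<in> white ori" "t = mate Red s"
    | "side s Red = side t Red" "em s = em t" "t \<in> white ori" "s = mate Red t"
    | "red_corner s = red_corner t" "violet_corner s = violet_corner t"
    | "red_corner s = red_corner t" "em s = em t"
proof -
  define c where "c = edge_colour ends a"
  have a: "side s c = side t c" using assms by (simp add: c_def side_edge_colour)
  then have ends: "ends (side s c) = ends (side t c)" by simp
  show thesis
  proof (cases c)
    case Red
    then have "em s = em t" using ends by (simp add: ends_side doubleton_eq_iff)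
    moreover have "s \<in> white ori \<longleftrightarrow> t \<notin> white ori" by (rule white_alternates[OF assms])
    ultimately show thesis using a Red mate_eqI[of s Red t] mate_eqI[of t Red s] that(1,2) by metis
  qed (use ends that(3,4) in \<open>simp_all add: ends_side doubleton_eq_iff\<close>)
qed

lemma corner_of_point: "\<exists>t. red_corner t = r" "\<exists>t. em t = e" "\<exists>t. violet_corner t = v"
  using used[of "RedPt r"] used[of "EmeraldPt e"] used[of "VioletPt v"] by (auto simp: corners_eq)

text \<open>Both sides of a balance axiom count black triangles with two given corners. Crossing the
  violet sides (at emerald points) or the emerald sides (at violet points) preserves both corners,
  while crossing the red sides turns \<open>red_opposite\<close> into the red corner.\<close>

lemma planar_web_red: "planar_web (white ori) red_corner red_opposite em violet_corner"
proof
  fix e r v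
  show "card {t \<in> white ori. em t = e \<and> red_corner t = r} = card {t \<in> white ori. em t = e \<and> red_opposite t = r}"
    using card_white_mate[of "\<lambda>t. em t = e \<and> red_corner t = r" Violet "\<lambda>t. em t = e \<and> red_corner t = r"]
      card_white_mate[of "\<lambda>t. em t = e \<and> red_corner t = r" Red "\<lambda>t. em t = e \<and> red_opposite t = r"]
    by (simp add: corners_mate red_opposite_def)
  show "card {t \<in> white ori. violet_corner t = v \<and> red_corner t = r} =
      card {t \<in> white ori. violet_corner t = v \<and> red_opposite t = r}"
    using card_white_mate[of "\<lambda>t. violet_corner t = v \<and> red_corner t = r" Emerald "\<lambda>t. violet_corner t = v \<and> red_corner t = r"]
      card_white_mate[of "\<lambda>t. violet_corner t = v \<and> red_corner t = r" Red "\<lambda>t. violet_corner t = v \<and> red_opposite t = r"]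
    by (simp add: corners_mate red_opposite_def)
next
  fix ke :: "'e \<Rightarrow> real" and kv :: "'v \<Rightarrow> real"
  assume eq: "\<And>t. t \<in> white ori \<Longrightarrow> ke (em t) = kv (violet_corner t)"
  have eq': "ke (em t) = kv (violet_corner t)" for t
  proof (cases "t \<in> white ori")
    case False
    then obtain s where "s \<in> white ori" "t = mate Red s"
      using bij_betw_imp_surj_on[OF bij_betw_mate[of Red]] by blast
    then show ?thesis using eq[of s] by (simp add: corners_mate)
  qed (rule eq)
  have const: "ke (em s) = ke (em t)" for s t
  proof (rule adjacent_constant)
    fix s t a assume "a \<in> sides s" "a \<in> sides t"
    then show "ke (em s) = ke (em t)"
      by (cases "s = t") (simp, rule adjacent_cases[of a s t], simp_all add: eq')
  qed
  show "\<exists>c. (\<forall>e. ke e = c) \<and> (\<forall>v. kv v = c)"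
  proof (intro exI conjI allI)
    fix e v
    obtain s u where su: "em s = e" "violet_corner u = v" using corner_of_point by blast
    show "ke e = ke (em undefined)" using const[of s] su by metis
    show "kv v = ke (em undefined)" using const[of u] su eq'[of u] by metis
  qed
next
  fix h :: "'r \<Rightarrow> real"
  assume eq: "\<And>t. t \<in> white ori \<Longrightarrow> h (red_corner t) = h (red_opposite t)"
  have const: "h (red_corner s) = h (red_corner t)" for s t
  proof (rule adjacent_constant)
    fix s t a assume "a \<in> sides s" "a \<in> sides t"
    then show "h (red_corner s) = h (red_corner t)"
      by (cases "s = t") (simp, rule adjacent_cases[of a s t], simp_all add: eq red_opposite_def)
  qed
  show "\<exists>c. \<forall>r. h r = c"
  proof (intro exI allI)
    fix r
    obtain s where "red_corner s = r" using corner_of_point by blast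
    then show "h r = h (red_corner undefined)" using const[of s] by metis
  qed
qed (rule card_white)

sublocale planar_web "white ori" red_corner red_opposite em violet_corner r\<^sub>0 for r\<^sub>0
  by (rule planar_web_red)

section \<open>Hypertrees, arborescences and flows\<close>

lemma inj_on_red_side: "inj_on (\<lambda>t. side t Red) (white ori)"
  by (rule bij_betw_imp_inj_on[OF bij_betw_side(1)])

lemma degree_in_red:
  assumes "T \<subseteq> white ori"
  shows "degree_in ends ((\<lambda>t. side t Red) ` T) (EmeraldPt e) = card {t \<in> T. em t = e}"
proof -
  have "{a \<in> (\<lambda>t. side t Red) ` T. EmeraldPt e \<in> ends a} = (\<lambda>t. side t Red) ` {t \<in> T. em t = e}"
    by (auto simp: ends_side)
  moreover have "inj_on (\<lambda>t. side t Red) {t \<in> T. em t = e}"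
    by (rule inj_on_subset[OF inj_on_red_side]) (use assms in auto)
  ultimately show ?thesis by (simp add: degree_in_def card_image)
qed

lemma graph_points_Red: "graph_points Red = range EmeraldPt \<union> range VioletPt"
proof -
  have "p \<in> graph_points Red \<longleftrightarrow> p \<in> range EmeraldPt \<union> range VioletPt" for p
    by (cases p) (auto simp: graph_points_def)
  then show ?thesis by blast
qed

lemma card_graph_points_Red: "card (graph_points Red :: ('r, 'e, 'v) point set) = CARD('e) + CARD('v)"
proof -
  have "card (range EmeraldPt \<union> range VioletPt :: ('r, 'e, 'v) point set) =
      card (range EmeraldPt :: ('r, 'e, 'v) point set) + card (range VioletPt :: ('r, 'e, 'v) point set)"
    by (rule card_Un_disjoint) auto
  then show ?thesis by (simp add: graph_points_Red card_image inj_on_def)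
qed

lemma arborescence_hypertree:
  assumes S: "arborescence r\<^sub>0 S" and deg: "\<And>e. card {t \<in> white ori - S. em t = e} = f e + 1"
  shows "hypertree ends f"
  unfolding hypertree_def
proof (intro exI conjI allI)
  let ?F = "(\<lambda>t. side t Red) ` (white ori - S)"
  show "degree_in ends ?F (EmeraldPt e) = f e + 1" for e
    using degree_in_red[of "white ori - S" e] deg[of e] by simp
  show "is_spanning_tree ends (graph_points Red) (graph_edges ends Red) ?F"
    unfolding is_spanning_tree_def
  proof
    show "?F \<subseteq> graph_edges ends Red" using bij_betw_imp_surj_on[OF bij_betw_side(1)[of Red]] by blast
    show "is_tree ends (graph_points Red) ?F"
    proof (rule is_treeI_card)
      show "graph_points Red \<noteq> ({} :: ('r, 'e, 'v) point set)" by (simp add: graph_points_Red)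
      show "ends a \<subseteq> graph_points Red" if "a \<in> ?F" for a
        using that by (auto simp: ends_side graph_points_Red)
      have "inj_on (\<lambda>t. side t Red) (white ori - S)" by (rule inj_on_subset[OF inj_on_red_side]) auto
      then show "card ?F + 1 = card (graph_points Red :: ('r, 'e, 'v) point set)"
        using card_arborescence[OF S] by (simp add: card_image card_graph_points_Red)
      fix p q :: "('r, 'e, 'v) point"
      assume pq: "p \<in> graph_points Red" "q \<in> graph_points Red"
      \<comment> \<open>The indicator of the component of \<open>p\<close> turns connectedness in
        terms of functions into the existence of paths.\<close>
      define k where "k x = (of_bool ((p, x) \<in> (joined ends ?F)\<^sup>*) :: real)" for x
      have "k (EmeraldPt (em t)) = k (VioletPt (violet_corner t))" if "t \<in> white ori - S" for t
      proof -
        have "(EmeraldPt (em t), VioletPt (violet_corner t)) \<in> joined ends ?F"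
          using that by (auto simp: joined_def ends_side)
        moreover from this have "(VioletPt (violet_corner t), EmeraldPt (em t)) \<in> joined ends ?F"
          by (rule joined_sym)
        ultimately have "(p, EmeraldPt (em t)) \<in> (joined ends ?F)\<^sup>* \<longleftrightarrow> (p, VioletPt (violet_corner t)) \<in> (joined ends ?F)\<^sup>*"
          using rtrancl_into_rtrancl[of p _ "joined ends ?F"] by blast
        then show ?thesis by (simp add: k_def)
      qed
      then obtain c where "\<And>e. k (EmeraldPt e) = c" "\<And>v. k (VioletPt v) = c"
        using complement_connected[OF S, of "\<lambda>e. k (EmeraldPt e)" "\<lambda>v. k (VioletPt v)"] by blast
      then have "k p = k q" using pq by (auto simp: graph_points_Red)
      then show "(p, q) \<in> (joined ends ?F)\<^sup>*" by (simp add: k_def split: split_of_bool_asm)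
    qed auto
  qed
qed

text \<open>The supplies depend on a real vector rather than on a function into the naturals, so
  that convexity makes sense.\<close>

definition is_flow :: "(real ^ 'e) \<Rightarrow> ('t \<Rightarrow> real) \<Rightarrow> bool" where
  "is_flow z x \<longleftrightarrow> (\<forall>t\<in>white ori. 0 \<le> x t) \<and>
     (\<forall>e. (\<Sum>t\<in>{t\<in>white ori. em t = e}. x t) = vec_nth z e + 1 / CARD('e)) \<and>
     (\<forall>v. (\<Sum>t\<in>{t\<in>white ori. violet_corner t = v}. x t) = 1)"

lemma hypertree_flow:
  assumes "hypertree ends f"
  obtains x where "is_flow (real_vector_of f) x"
proof -
  obtain F where F: "is_tree ends (graph_points Red) F" "F \<subseteq> graph_edges ends Red"
    "\<And>e. degree_in ends F (EmeraldPt e) = f e + 1"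
    using assms by (auto simp: hypertree_def is_spanning_tree_def)
  define T where "T = {t \<in> white ori. side t Red \<in> F}"
  have image: "(\<lambda>t. side t Red) ` T = F"
    using F(2) bij_betw_imp_surj_on[OF bij_betw_side(1)[of Red]] by (auto simp: T_def)
  have TW: "T \<subseteq> white ori" by (auto simp: T_def)
  have deg: "card {t \<in> T. em t = e} = f e + 1" for e
    using degree_in_red[OF TW, of e] F(3)[of e] image by simp
  have par: "\<exists>\<alpha> \<beta>. (\<forall>e. e \<noteq> e\<^sub>1 \<longrightarrow> \<alpha> e \<in> T \<and> em (\<alpha> e) = e) \<and> (\<forall>v. \<beta> v \<in> T \<and> violet_corner (\<beta> v) = v) \<and>
      (\<forall>e v. e \<noteq> e\<^sub>1 \<longrightarrow> \<alpha> e \<noteq> \<beta> v) \<and> T \<subseteq> \<alpha> ` (- {e\<^sub>1}) \<union> range \<beta>" for e\<^sub>1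
  proof -
    let ?U = "graph_points Red - {EmeraldPt e\<^sub>1} :: ('r, 'e, 'v) point set"
    have "EmeraldPt e\<^sub>1 \<in> (graph_points Red :: ('r, 'e, 'v) point set)" by (simp add: graph_points_Red)
    then obtain \<pi> where \<pi>: "bij_betw \<pi> ?U F" "\<And>p. p \<in> ?U \<Longrightarrow> p \<in> ends (\<pi> p)"
      using is_tree_parent_edges[OF F(1)] ends by metis
    have "\<exists>t\<in>T. side t Red = \<pi> p" if "p \<in> ?U" for p
      using bij_betw_apply[OF \<pi>(1) that] image by auto
    then obtain \<tau> where \<tau>: "\<And>p. p \<in> ?U \<Longrightarrow> \<tau> p \<in> T \<and> side (\<tau> p) Red = \<pi> p" by metis
    have U: "EmeraldPt e \<in> ?U" if "e \<noteq> e\<^sub>1" for e using that by (simp add: graph_points_Red)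
    have U': "VioletPt v \<in> ?U" for v by (simp add: graph_points_Red)
    have em: "em (\<tau> (EmeraldPt e)) = e" if "e \<noteq> e\<^sub>1" for e
      using \<pi>(2)[OF U[OF that]] \<tau>[OF U[OF that]] ends_side(1)[of "\<tau> (EmeraldPt e)"] by simp
    have vi: "violet_corner (\<tau> (VioletPt v)) = v" for v
      using \<pi>(2)[OF U'[of v]] \<tau>[OF U'[of v]] ends_side(1)[of "\<tau> (VioletPt v)"] by simp
    have "\<tau> (EmeraldPt e) \<noteq> \<tau> (VioletPt v)" if "e \<noteq> e\<^sub>1" for e v
    proof
      assume "\<tau> (EmeraldPt e) = \<tau> (VioletPt v)"
      then have "\<pi> (EmeraldPt e) = \<pi> (VioletPt v)" using \<tau> U[OF that] U' by metis
      then show False using bij_betw_imp_inj_on[OF \<pi>(1)] U[OF that] U'[of v] by (auto dest: inj_onD)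
    qed
    moreover have "T \<subseteq> (\<lambda>e. \<tau> (EmeraldPt e)) ` (- {e\<^sub>1}) \<union> range (\<lambda>v. \<tau> (VioletPt v))"
    proof
      fix t assume t: "t \<in> T"
      then have "side t Red \<in> \<pi> ` ?U" using image bij_betw_imp_surj_on[OF \<pi>(1)] by blast
      then obtain p where p: "p \<in> ?U" "side t Red = \<pi> p" by blast
      then have "t = \<tau> p" using \<tau>[OF p(1)] t TW inj_onD[OF inj_on_red_side, of t "\<tau> p"] by auto
      then show "t \<in> (\<lambda>e. \<tau> (EmeraldPt e)) ` (- {e\<^sub>1}) \<union> range (\<lambda>v. \<tau> (VioletPt v))"
        using p(1) by (auto simp: graph_points_Red)
    qed
    ultimately show ?thesis
      using \<tau> U U' em vi
      by (intro exI[of _ "\<lambda>e. \<tau> (EmeraldPt e)"] exI[of _ "\<lambda>v. \<tau> (VioletPt v)"]) blast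
  qed
  obtain x where "\<And>t. t \<in> white ori \<Longrightarrow> 0 \<le> x t"
    "\<And>e. (\<Sum>t\<in>{t\<in>white ori. em t = e}. x t) = real (f e) + 1 / CARD('e)"
    "\<And>v. (\<Sum>t\<in>{t\<in>white ori. violet_corner t = v}. x t) = 1"
    using tree_flow[OF TW deg par] by blast
  then have "is_flow (real_vector_of f) x" by (simp add: is_flow_def real_vector_of_def)
  then show thesis by (rule that)
qed

lemma flow_hypertree:
  assumes "is_flow (real_vector_of f) x"
  shows "\<exists>S. arborescence r\<^sub>0 S \<and> (\<forall>e. card {t \<in> white ori - S. em t = e} = f e + 1)"
proof -
  have flow: "\<And>t. t \<in> white ori \<Longrightarrow> 0 \<le> x t"
    "\<And>e. (\<Sum>t\<in>{t\<in>white ori. em t = e}. x t) = real (f e) + 1 / CARD('e)"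
    "\<And>v. (\<Sum>t\<in>{t\<in>white ori. violet_corner t = v}. x t) = 1"
    using assms by (simp_all add: is_flow_def real_vector_of_def)
  show ?thesis by (rule flow_arborescence[OF flow, where r\<^sub>0 = r\<^sub>0]) (assumption | blast)+
qed

text \<open>As the weights add up to 1, the excess \<open>1 / CARD('e)\<close> is reproduced by
  convex combinations. Nonnegativity of \<open>z\<close> is carried along so that an integer point
  comes from a function into the naturals.\<close>

lemma convex_flow: "convex {z. (\<forall>e. 0 \<le> vec_nth z e) \<and> (\<exists>x. is_flow z x)}"
proof (rule convexI)
  fix z z' and a b :: real
  assume ab: "0 \<le> a" "0 \<le> b" "a + b = 1"
    and "z \<in> {z. (\<forall>e. 0 \<le> vec_nth z e) \<and> (\<exists>x. is_flow z x)}"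
    and "z' \<in> {z. (\<forall>e. 0 \<le> vec_nth z e) \<and> (\<exists>x. is_flow z x)}"
  then obtain x x' where z: "\<And>e. 0 \<le> vec_nth z e" "\<And>e. 0 \<le> vec_nth z' e"
    and x: "is_flow z x" "is_flow z' x'" by blast
  have b: "b = 1 - a" using ab(3) by simp
  have "a * (y + k) + b * (y' + k) = a * y + b * y' + k" for y y' k :: real
    by (simp add: b algebra_simps)
  then have "is_flow (a *\<^sub>R z + b *\<^sub>R z') (\<lambda>t. a * x t + b * x' t)"
    using x ab by (simp add: is_flow_def sum.distrib sum_distrib_left[symmetric])
  then show "a *\<^sub>R z + b *\<^sub>R z' \<in> {z. (\<forall>e. 0 \<le> vec_nth z e) \<and> (\<exists>x. is_flow z x)}"
    using z ab by auto
qed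

lemma hypertree_polytope_integer_points:
  "hypertree_polytope ends \<inter> integer_vectors = real_vector_of ` {f. hypertree ends f}"
proof
  show "real_vector_of ` {f. hypertree ends f} \<subseteq> hypertree_polytope ends \<inter> integer_vectors"
    by (auto simp: hypertree_polytope_def integer_vectors_def real_vector_of_def intro: hull_inc)
  have "hypertree_polytope ends \<subseteq> {z. (\<forall>e. 0 \<le> vec_nth z e) \<and> (\<exists>x. is_flow z x)}"
    unfolding hypertree_polytope_def
  proof (rule hull_minimal)
    show "real_vector_of ` {f. hypertree ends f} \<subseteq> {z. (\<forall>e. 0 \<le> vec_nth z e) \<and> (\<exists>x. is_flow z x)}"
    proof clarify
      fix f :: "'e \<Rightarrow> nat" assume "hypertree ends f"
      then obtain x where "is_flow (real_vector_of f) x" by (rule hypertree_flow)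
      then show "(\<forall>e. 0 \<le> vec_nth (real_vector_of f) e) \<and> (\<exists>x. is_flow (real_vector_of f) x)"
        by (auto simp: real_vector_of_def)
    qed
  qed (rule convex_flow)
  moreover have "z \<in> real_vector_of ` {f. hypertree ends f}"
    if z: "\<forall>e. 0 \<le> vec_nth z e" "is_flow z x" "z \<in> integer_vectors" for z x
  proof -
    define f where "f e = nat \<lfloor>vec_nth z e\<rfloor>" for e
    have "real (f e) = vec_nth z e" for e
      using z by (auto simp: f_def integer_vectors_def elim!: Ints_cases[of "vec_nth z e" for e])
    then have "z = real_vector_of f"
      by (simp add: real_vector_of_def Finite_Cartesian_Product.vec_eq_iff)
    moreover from this have "is_flow (real_vector_of f) x" using z(2) by simp
    then have "hypertree ends f" using flow_hypertree arborescence_hypertree by blast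
    ultimately show ?thesis by blast
  qed
  ultimately show "hypertree_polytope ends \<inter> integer_vectors \<subseteq> real_vector_of ` {f. hypertree ends f}"
    by blast
qed

end

section \<open>Expansion of the determinant\<close>

lemma continuous_on_same_sign:
  fixes \<phi> :: "real \<Rightarrow> real"
  assumes "continuous_on {0..1} \<phi>" "\<And>s. 0 \<le> s \<Longrightarrow> s \<le> 1 \<Longrightarrow> \<phi> s \<noteq> 0"
  shows "sgn (\<phi> 0) = sgn (\<phi> 1)"
proof (rule ccontr)
  assume "sgn (\<phi> 0) \<noteq> sgn (\<phi> 1)"
  then consider "\<phi> 0 \<le> 0" "0 \<le> \<phi> 1" | "0 \<le> \<phi> 0" "\<phi> 1 \<le> 0"
    by (auto simp: sgn_if split: if_splits)
  then show False
    using IVT'[of \<phi> 0 0 1] IVT2'[of \<phi> 1 0 0] assms by cases fastforce+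
qed

lemma prod_single: "finite A \<Longrightarrow> (\<Prod>i\<in>A. Poly_Mapping.single (g i) (1 :: int)) = Poly_Mapping.single (sum g A) 1"
  for g :: "'b \<Rightarrow> ('e \<Rightarrow>\<^sub>0 nat)"
  by (induction A rule: finite_induct) (simp_all add: mult_single)

lemma lookup_of_int_single:
  "Poly_Mapping.lookup (of_int k * Poly_Mapping.single m (1 :: int) :: 'e int_poly) m' = (if m = m' then k else 0)"
proof -
  have "(of_int k :: 'e int_poly) = Poly_Mapping.single 0 k" by (metis single_of_int of_int_eq_id id_apply)
  then show ?thesis by (simp add: mult_single lookup_single when_def)
qed

locale rooted_trinity = trinity ends sides ori
  for ends :: "'a::finite \<Rightarrow> ('r::finite, 'e::finite, 'v::finite) point set"
    and sides :: "'t::finite \<Rightarrow> 'a set"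
    and ori :: "'t \<Rightarrow> (('r, 'e, 'v) point \<times> ('r, 'e, 'v) point) set" +
  fixes t\<^sub>0 :: 't and r\<^sub>0 :: 'r and e\<^sub>0 :: 'e and v\<^sub>0 :: 'v
    and ps :: "('r, 'e, 'v) point list" and ts :: "'t list"
  assumes root_white: "t\<^sub>0 \<in> white ori"
    and root_corners: "corners ends sides t\<^sub>0 = {RedPt r\<^sub>0, EmeraldPt e\<^sub>0, VioletPt v\<^sub>0}"
    and distinct_ps: "distinct ps" and set_ps: "set ps = UNIV - {RedPt r\<^sub>0, EmeraldPt e\<^sub>0, VioletPt v\<^sub>0}"
    and distinct_ts: "distinct ts" and set_ts: "set ts = white ori - {t\<^sub>0}"
begin

section \<open>Square matrices indexed by points and triangles\<close>

abbreviation n :: nat where "n \<equiv> length ts"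

abbreviation W\<^sub>0 :: "'t set" where "W\<^sub>0 \<equiv> white ori - {t\<^sub>0}"

lemma root_corner [simp]: "red_corner t\<^sub>0 = r\<^sub>0" "em t\<^sub>0 = e\<^sub>0" "violet_corner t\<^sub>0 = v\<^sub>0"
  using root_corners by (auto simp: corners_eq insert_commute)

lemma length_ps: "length ps = n"
proof -
  have "length ps = CARD(('r, 'e, 'v) point) - 3"
    using distinct_card[OF distinct_ps] set_ps by (simp add: card_Diff_subset)
  moreover have "n = card (white ori) - 1"
    using distinct_card[OF distinct_ts] set_ts root_white by simp
  ultimately show ?thesis
    using card_white by (simp add: card_UNIV_point)
qed

lemma bij_ts: "bij_betw ((!) ts) {0..<n} W\<^sub>0"
  by (rule bij_betw_nth) (simp_all add: distinct_ts set_ts lessThan_atLeast0)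

text \<open>The type of the entries is left open: the same indexing serves the polynomial matrix and
  the real matrices compared with it.\<close>

definition point_matrix :: "(('r, 'e, 'v) point \<Rightarrow> 't \<Rightarrow> 'x) \<Rightarrow> 'x mat" where
  "point_matrix g = Matrix.mat n n (\<lambda>(i, j). g (ps ! i) (ts ! j))"

lemma det_point_matrix:
  "Determinant.det (point_matrix g) =
    (\<Sum>p | p permutes {0..<n}. signof p * (\<Prod>i = 0..<n. g (ps ! i) (ts ! (p i))))"
proof -
  have "(\<Prod>i = 0..<n. point_matrix g $$ (i, p i)) = (\<Prod>i = 0..<n. g (ps ! i) (ts ! (p i)))"
    if "p permutes {0..<n}" for p
    by (rule prod.cong) (use permutes_in_image[OF that] in \<open>auto simp: point_matrix_def\<close>)
  then show ?thesis
    using det_def'[of "point_matrix g" n] by (simp add: point_matrix_def)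
qed

text \<open>Kernel vectors are expressed as functions on triangles, ready to be read as functions on
  the edges of G_R.\<close>

lemma point_matrix_singular_iff:
  fixes g :: "('r, 'e, 'v) point \<Rightarrow> 't \<Rightarrow> real"
  shows "Determinant.det (point_matrix g) = 0 \<longleftrightarrow>
    (\<exists>c. (\<exists>t\<in>W\<^sub>0. c t \<noteq> 0) \<and> (\<forall>p\<in>set ps. (\<Sum>t\<in>W\<^sub>0. g p t * c t) = 0))"
proof -
  have G: "point_matrix g \<in> carrier_mat n n" by (simp add: point_matrix_def)
  have row: "(point_matrix g *\<^sub>v Matrix.vec n (\<lambda>j. c (ts ! j))) $ i = (\<Sum>t\<in>W\<^sub>0. g (ps ! i) t * c t)" if "i < n" for i c
  proof -
    have "(point_matrix g *\<^sub>v Matrix.vec n (\<lambda>j. c (ts ! j))) $ i = (\<Sum>j\<in>{0..<n}. g (ps ! i) (ts ! j) * c (ts ! j))"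
      using that by (simp add: point_matrix_def scalar_prod_def)
    also have "\<dots> = (\<Sum>t\<in>W\<^sub>0. g (ps ! i) t * c t)"
      by (rule sum.reindex_bij_betw[OF bij_ts])
    finally show ?thesis .
  qed
  have "(\<exists>y. y \<in> carrier_vec n \<and> y \<noteq> 0\<^sub>v n \<and> point_matrix g *\<^sub>v y = 0\<^sub>v n) \<longleftrightarrow>
    (\<exists>c. Matrix.vec n (\<lambda>j. c (ts ! j)) \<noteq> 0\<^sub>v n \<and> point_matrix g *\<^sub>v Matrix.vec n (\<lambda>j. c (ts ! j)) = 0\<^sub>v n)"
  proof
    assume "\<exists>y. y \<in> carrier_vec n \<and> y \<noteq> 0\<^sub>v n \<and> point_matrix g *\<^sub>v y = 0\<^sub>v n"
    then obtain y where y: "y \<in> carrier_vec n" "y \<noteq> 0\<^sub>v n" "point_matrix g *\<^sub>v y = 0\<^sub>v n" by blast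
    have "Matrix.vec n (\<lambda>j. y $ the_inv_into {0..<n} ((!) ts) (ts ! j)) = y"
      using y(1) the_inv_into_f_f[OF bij_betw_imp_inj_on[OF bij_ts]] by (intro eq_vecI) auto
    with y show "\<exists>c. Matrix.vec n (\<lambda>j. c (ts ! j)) \<noteq> 0\<^sub>v n \<and> point_matrix g *\<^sub>v Matrix.vec n (\<lambda>j. c (ts ! j)) = 0\<^sub>v n"
      by (intro exI[of _ "\<lambda>t. y $ the_inv_into {0..<n} ((!) ts) t"]) simp
  qed (metis vec_carrier)
  also have "\<dots> \<longleftrightarrow> (\<exists>c. (\<exists>t\<in>W\<^sub>0. c t \<noteq> 0) \<and> (\<forall>p\<in>set ps. (\<Sum>t\<in>W\<^sub>0. g p t * c t) = 0))"
  proof (rule ex_cong1)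
    fix c :: "'t \<Rightarrow> real"
    have "Matrix.vec n (\<lambda>j. c (ts ! j)) = 0\<^sub>v n \<longleftrightarrow> (\<forall>t\<in>W\<^sub>0. c t = 0)"
      unfolding set_ts[symmetric] by (simp add: Matrix.vec_eq_iff all_set_conv_all_nth)
    moreover have "point_matrix g *\<^sub>v Matrix.vec n (\<lambda>j. c (ts ! j)) = 0\<^sub>v n \<longleftrightarrow>
        (\<forall>i<n. (point_matrix g *\<^sub>v Matrix.vec n (\<lambda>j. c (ts ! j))) $ i = 0)"
      using G by (auto simp: Matrix.vec_eq_iff)
    then have "point_matrix g *\<^sub>v Matrix.vec n (\<lambda>j. c (ts ! j)) = 0\<^sub>v n \<longleftrightarrow>
        (\<forall>p\<in>set ps. (\<Sum>t\<in>W\<^sub>0. g p t * c t) = 0)"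
      by (simp add: row all_set_conv_all_nth length_ps)
    ultimately show "(Matrix.vec n (\<lambda>j. c (ts ! j)) \<noteq> 0\<^sub>v n \<and> point_matrix g *\<^sub>v Matrix.vec n (\<lambda>j. c (ts ! j)) = 0\<^sub>v n) \<longleftrightarrow>
        (\<exists>t\<in>W\<^sub>0. c t \<noteq> 0) \<and> (\<forall>p\<in>set ps. (\<Sum>t\<in>W\<^sub>0. g p t * c t) = 0)" by blast
  qed
  finally show ?thesis by (simp add: det_0_iff_vec_prod_zero_field[OF G])
qed

section \<open>Kernel vectors as circulations\<close>

text \<open>Summing \<open>c\<close> by emerald or by violet points shows that the sums at the two
  roots both equal the total. The outer triangle is an edge between these roots, so one value on it
  cancels both.\<close>

lemma circulation_extend:
  assumes e: "\<And>e. e \<noteq> e\<^sub>0 \<Longrightarrow> (\<Sum>t\<in>{t\<in>W\<^sub>0. em t = e}. c t) = 0"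
    and v: "\<And>v. v \<noteq> v\<^sub>0 \<Longrightarrow> (\<Sum>t\<in>{t\<in>W\<^sub>0. violet_corner t = v}. c t) = 0"
  obtains c' where "circulation c'" "\<And>t. t \<in> W\<^sub>0 \<Longrightarrow> c' t = c t"
proof -
  define c' where "c' = c(t\<^sub>0 := - (\<Sum>t\<in>W\<^sub>0. c t))"
  have insert: "(\<Sum>t\<in>{t\<in>white ori. P t}. c' t) = (\<Sum>t\<in>{t\<in>W\<^sub>0. P t}. c t) + (if P t\<^sub>0 then - (\<Sum>t\<in>W\<^sub>0. c t) else 0)" for P
  proof -
    have "{t\<in>white ori. P t} = {t\<in>W\<^sub>0. P t} \<union> {t\<in>{t\<^sub>0}. P t}" using root_white by auto
    then have "(\<Sum>t\<in>{t\<in>white ori. P t}. c' t) = (\<Sum>t\<in>{t\<in>W\<^sub>0. P t}. c' t) + (\<Sum>t\<in>{t\<in>{t\<^sub>0}. P t}. c' t)"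
      by (simp only:) (rule sum.union_disjoint, auto)
    moreover have "(\<Sum>t\<in>{t\<in>W\<^sub>0. P t}. c' t) = (\<Sum>t\<in>{t\<in>W\<^sub>0. P t}. c t)"
      by (rule sum.cong) (auto simp: c'_def)
    moreover have "(\<Sum>t\<in>{t\<in>{t\<^sub>0}. P t}. c' t) = (if P t\<^sub>0 then - (\<Sum>t\<in>W\<^sub>0. c t) else 0)"
    proof (cases "P t\<^sub>0")
      case True
      then have "{t\<in>{t\<^sub>0}. P t} = {t\<^sub>0}" by auto
      then show ?thesis using True by (simp add: c'_def)
    next
      case False
      then have "{t\<in>{t\<^sub>0}. P t} = {}" by auto
      then show ?thesis using False by (simp only: sum.empty if_False)
    qed
    ultimately show ?thesis by simp
  qed
  have "(\<Sum>t\<in>W\<^sub>0. c t) = (\<Sum>e\<in>UNIV. \<Sum>t\<in>{t\<in>W\<^sub>0. em t = e}. c t)"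
    by (rule sum.group[symmetric]) auto
  also have "\<dots> = (\<Sum>e\<in>{e\<^sub>0}. \<Sum>t\<in>{t\<in>W\<^sub>0. em t = e}. c t)"
    by (rule sum.mono_neutral_right) (use e in auto)
  finally have tot_e: "(\<Sum>t\<in>{t\<in>W\<^sub>0. em t = e\<^sub>0}. c t) = (\<Sum>t\<in>W\<^sub>0. c t)" by simp
  have "(\<Sum>t\<in>W\<^sub>0. c t) = (\<Sum>v\<in>UNIV. \<Sum>t\<in>{t\<in>W\<^sub>0. violet_corner t = v}. c t)"
    by (rule sum.group[symmetric]) auto
  also have "\<dots> = (\<Sum>v\<in>{v\<^sub>0}. \<Sum>t\<in>{t\<in>W\<^sub>0. violet_corner t = v}. c t)"
    by (rule sum.mono_neutral_right) (use v in auto)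
  finally have tot_v: "(\<Sum>t\<in>{t\<in>W\<^sub>0. violet_corner t = v\<^sub>0}. c t) = (\<Sum>t\<in>W\<^sub>0. c t)" by simp
  have "circulation c'"
    unfolding circulation_def insert
  proof (intro conjI allI)
    fix e show "(\<Sum>t\<in>{t\<in>W\<^sub>0. em t = e}. c t) + (if em t\<^sub>0 = e then - (\<Sum>t\<in>W\<^sub>0. c t) else 0) = 0"
      using e[of e] tot_e by (cases "e = e\<^sub>0") auto
    fix v show "(\<Sum>t\<in>{t\<in>W\<^sub>0. violet_corner t = v}. c t) + (if violet_corner t\<^sub>0 = v then - (\<Sum>t\<in>W\<^sub>0. c t) else 0) = 0"
      using v[of v] tot_v by (cases "v = v\<^sub>0") auto
  qed
  moreover have "c' t = c t" if "t \<in> W\<^sub>0" for t using that by (simp add: c'_def)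
  ultimately show thesis by (rule that)
qed

text \<open>A circulation cannot live on the outer triangle alone, since its sum at the emerald root
  would be the value there.\<close>

lemma circulation_root:
  assumes c: "circulation c" and z: "\<And>t. t \<in> W\<^sub>0 \<Longrightarrow> c t = 0" and t: "t \<in> white ori"
  shows "c t = 0"
proof (cases "t = t\<^sub>0")
  case True
  have "(\<Sum>t\<in>{t\<in>white ori. em t = e\<^sub>0}. c t) = (\<Sum>t\<in>{t\<^sub>0}. c t)"
    by (rule sum.mono_neutral_right) (use root_white z in auto)
  then show ?thesis using c True by (simp add: circulation_def)
qed (use z t in auto)

text \<open>
  For \<open>a = 1\<close> and \<open>b = 0\<close>, the determinant with these rows collects the expansion terms in which the red
  points are matched within \<open>S\<close>. The general case interpolates between two sets.
\<close>

definition red_row :: "real \<Rightarrow> 't set \<Rightarrow> real \<Rightarrow> 't set \<Rightarrow> ('r, 'e, 'v) point \<Rightarrow> 't \<Rightarrow> real" where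
  "red_row a S b S' p t = (if p \<notin> corners ends sides t then 0
     else if colour_of p = Red then a * of_bool (t \<in> S) + b * of_bool (t \<in> S') else 1)"

definition transversal :: "'t set \<Rightarrow> bool" where
  "transversal S \<longleftrightarrow> S \<subseteq> white ori \<and> bij_betw red_corner S (UNIV - {r\<^sub>0})"

lemma arborescence_transversal: "arborescence r\<^sub>0 S \<Longrightarrow> transversal S"
  by (simp add: arborescence_def transversal_def)

lemma transversal_W\<^sub>0:
  assumes "transversal S"
  shows "S \<subseteq> W\<^sub>0"
proof
  fix t assume t: "t \<in> S"
  then have "red_corner t \<in> UNIV - {r\<^sub>0}" "t \<in> white ori"
    using assms bij_betw_apply[of red_corner S] unfolding transversal_def by blast+
  then show "t \<in> W\<^sub>0" by auto
qed

lemma sum_transversal: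
  assumes S: "transversal S" "s \<in> S"
  shows "(\<Sum>t\<in>{t\<in>W\<^sub>0. red_corner t = red_corner s}. of_bool (t \<in> S) * c t) = (c s :: real)"
proof -
  have "inj_on red_corner S" using S by (simp add: transversal_def bij_betw_def)
  then have "(\<Sum>t\<in>{t\<in>W\<^sub>0. red_corner t = red_corner s}. of_bool (t \<in> S) * c t) = (\<Sum>t\<in>{s}. of_bool (t \<in> S) * c t)"
    using S transversal_W\<^sub>0[OF S(1)] by (intro sum.mono_neutral_right) (auto dest: inj_onD)
  then show ?thesis using S by simp
qed

lemma red_row_sum:
  "(\<Sum>t\<in>W\<^sub>0. red_row a S b S' (EmeraldPt e) t * c t) = (\<Sum>t\<in>{t\<in>W\<^sub>0. em t = e}. c t)"
  "(\<Sum>t\<in>W\<^sub>0. red_row a S b S' (VioletPt v) t * c t) = (\<Sum>t\<in>{t\<in>W\<^sub>0. violet_corner t = v}. c t)"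
  "(\<Sum>t\<in>W\<^sub>0. red_row a S b S' (RedPt r) t * c t) =
    a * (\<Sum>t\<in>{t\<in>W\<^sub>0. red_corner t = r}. of_bool (t \<in> S) * c t) + b * (\<Sum>t\<in>{t\<in>W\<^sub>0. red_corner t = r}. of_bool (t \<in> S') * c t)"
proof -
  have filter: "(\<Sum>t\<in>W\<^sub>0. if P t then f t else 0) = (\<Sum>t\<in>{t\<in>W\<^sub>0. P t}. f t)" for P and f :: "'t \<Rightarrow> real"
    by (rule sum.inter_filter[symmetric]) simp
  show "(\<Sum>t\<in>W\<^sub>0. red_row a S b S' (EmeraldPt e) t * c t) = (\<Sum>t\<in>{t\<in>W\<^sub>0. em t = e}. c t)"
    unfolding filter[symmetric] by (rule sum.cong) (auto simp: red_row_def corners_eq)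
  show "(\<Sum>t\<in>W\<^sub>0. red_row a S b S' (VioletPt v) t * c t) = (\<Sum>t\<in>{t\<in>W\<^sub>0. violet_corner t = v}. c t)"
    unfolding filter[symmetric] by (rule sum.cong) (auto simp: red_row_def corners_eq)
  show "(\<Sum>t\<in>W\<^sub>0. red_row a S b S' (RedPt r) t * c t) =
    a * (\<Sum>t\<in>{t\<in>W\<^sub>0. red_corner t = r}. of_bool (t \<in> S) * c t) + b * (\<Sum>t\<in>{t\<in>W\<^sub>0. red_corner t = r}. of_bool (t \<in> S') * c t)"
    unfolding sum_distrib_left sum.distrib[symmetric] filter[symmetric]
    by (rule sum.cong) (auto simp: red_row_def corners_eq algebra_simps)
qed

lemma det_not_arborescence:
  assumes S: "transversal S" "\<not> arborescence r\<^sub>0 S"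
  shows "Determinant.det (point_matrix (red_row 1 S 0 S')) = 0"
proof -
  obtain c t where c: "circulation c" "\<And>t. t \<in> S \<Longrightarrow> c t = 0" "t \<in> white ori" "c t \<noteq> 0"
    using transversal_circulation[of S r\<^sub>0] S unfolding transversal_def by metis
  have "\<exists>t\<in>W\<^sub>0. c t \<noteq> 0" using circulation_root[OF c(1) _ c(3)] c(4) by blast
  moreover have "(\<Sum>t\<in>W\<^sub>0. red_row 1 S 0 S' p t * c t) = 0" if "p \<in> set ps" for p
  proof (cases p)
    case (RedPt r)
    have "(\<Sum>t\<in>{t\<in>W\<^sub>0. red_corner t = r}. of_bool (t \<in> S) * c t) = 0"
      by (rule sum.neutral) (auto simp: c(2))
    then show ?thesis by (simp only: RedPt red_row_sum)
  next
    case (EmeraldPt e)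
    then have "e \<noteq> em t\<^sub>0" using that by (simp add: set_ps)
    \<comment> \<open>The outer triangle does not touch \<open>e\<close>, so the missing column does
      not disturb the sum.\<close>
    then have "{t\<in>W\<^sub>0. em t = e} = {t\<in>white ori. em t = e}" by blast
    then show ?thesis unfolding EmeraldPt red_row_sum using c(1) by (simp only: circulation_def)
  next
    case (VioletPt v)
    then have "v \<noteq> violet_corner t\<^sub>0" using that by (simp add: set_ps)
    then have "{t\<in>W\<^sub>0. violet_corner t = v} = {t\<in>white ori. violet_corner t = v}" by blast
    then show ?thesis unfolding VioletPt red_row_sum using c(1) by (simp only: circulation_def)
  qed
  ultimately show ?thesis unfolding point_matrix_singular_iff by blast
qed

text \<open>A kernel vector has zero sums at the non-root emerald and violet points, so it extends
  to a circulation. The red rows provide exactly the relation to which the maximum principle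
  applies.\<close>

lemma det_mixture_nonzero:
  assumes S: "arborescence r\<^sub>0 S" "arborescence r\<^sub>0 S'" and ab: "0 \<le> a" "0 \<le> b" "a + b > 0"
  shows "Determinant.det (point_matrix (red_row a S b S')) \<noteq> 0"
proof
  assume "Determinant.det (point_matrix (red_row a S b S')) = 0"
  then obtain c u where u: "u \<in> W\<^sub>0" "c u \<noteq> 0"
    and c: "\<And>p. p \<in> set ps \<Longrightarrow> (\<Sum>t\<in>W\<^sub>0. red_row a S b S' p t * c t) = 0"
    unfolding point_matrix_singular_iff by blast
  have tr: "transversal S" "transversal S'" using S by (simp_all add: arborescence_transversal)
  have e: "(\<Sum>t\<in>{t\<in>W\<^sub>0. em t = e}. c t) = 0" if "e \<noteq> e\<^sub>0" for e
    using c[of "EmeraldPt e"] that unfolding red_row_sum by (simp add: set_ps)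
  have v: "(\<Sum>t\<in>{t\<in>W\<^sub>0. violet_corner t = v}. c t) = 0" if "v \<noteq> v\<^sub>0" for v
    using c[of "VioletPt v"] that unfolding red_row_sum by (simp add: set_ps)
  obtain c' where c': "circulation c'" "\<And>t. t \<in> W\<^sub>0 \<Longrightarrow> c' t = c t"
    using circulation_extend[of c, OF e v] by blast
  have "a * c' s + b * c' s' = 0" if s: "s \<in> S" "s' \<in> S'" "red_corner s = red_corner s'" for s s'
  proof -
    have "red_corner s \<noteq> r\<^sub>0" using tr(1) s(1) by (auto simp: transversal_def bij_betw_def)
    then have "(\<Sum>t\<in>W\<^sub>0. red_row a S b S' (RedPt (red_corner s)) t * c t) = 0"
      using set_ps by (intro c) simp
    then have "a * c s + b * c s' = 0"
      unfolding red_row_sum using sum_transversal[OF tr(1) s(1), of c] sum_transversal[OF tr(2) s(2), of c] s(3)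
      by (simp del: sum_mult_of_bool_eq sum_of_bool_mult_eq)
    then show ?thesis using c'(2) s transversal_W\<^sub>0 tr by (metis subsetD)
  qed
  then have "c' u = 0" using u by (intro circulation_mixture_zero[OF S ab c'(1)]) auto
  then show False using u c'(2) by simp
qed

lemma det_same_sign:
  assumes S: "arborescence r\<^sub>0 S" "arborescence r\<^sub>0 S'"
  shows "sgn (Determinant.det (point_matrix (red_row 1 S 0 S'))) = sgn (Determinant.det (point_matrix (red_row 0 S 1 S')))"
proof -
  define \<phi> where "\<phi> s = Determinant.det (point_matrix (red_row (1 - s) S s S'))" for s
  have "continuous_on {0..1} (\<lambda>s. red_row (1 - s) S s S' p t)" for p t
    by (cases "p \<in> corners ends sides t"; cases "colour_of p = Red")
       (auto simp: red_row_def intro!: continuous_intros)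
  then have "continuous_on {0..1} \<phi>"
    unfolding \<phi>_def det_point_matrix by (intro continuous_intros)
  moreover have "\<phi> s \<noteq> 0" if "0 \<le> s" "s \<le> 1" for s
    unfolding \<phi>_def by (rule det_mixture_nonzero[OF S]) (use that in auto)
  ultimately have "sgn (\<phi> 0) = sgn (\<phi> 1)" by (rule continuous_on_same_sign)
  then show ?thesis by (simp add: \<phi>_def)
qed

section \<open>Matchings of points with triangles\<close>

definition matching :: "(nat \<Rightarrow> nat) \<Rightarrow> bool" where
  "matching p \<longleftrightarrow> p permutes {0..<n} \<and> (\<forall>i<n. ps ! i \<in> corners ends sides (ts ! p i))"

definition matched :: "colour \<Rightarrow> (nat \<Rightarrow> nat) \<Rightarrow> 't set" where
  "matched c p = (\<lambda>i. ts ! p i) ` {i. i < n \<and> colour_of (ps ! i) = c}"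

definition exponent :: "(nat \<Rightarrow> nat) \<Rightarrow> 'e \<Rightarrow>\<^sub>0 nat" where
  "exponent p = (\<Sum>i = 0..<n. if colour_of (ps ! i) = Violet then Poly_Mapping.single (em (ts ! p i)) 1 else 0)"

lemma finite_matchings: "finite {p. matching p}"
  by (rule finite_subset[OF _ finite_permutations[of "{0..<n}"]]) (auto simp: matching_def)

lemma det_enhanced_matrix:
  "Determinant.det (enhanced_matrix ends sides ps ts) =
    (\<Sum>p | matching p. of_int (sign p) * Poly_Mapping.single (exponent p) 1)"
proof -
  have M: "enhanced_matrix ends sides ps ts = point_matrix (enhanced_entry ends sides)"
    by (simp add: enhanced_matrix_def point_matrix_def length_ps)
  have 1: "(\<Prod>i = 0..<n. enhanced_entry ends sides (ps ! i) (ts ! p i)) = Poly_Mapping.single (exponent p) 1"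
    if "matching p" for p
    unfolding exponent_def prod_single[OF finite_atLeastLessThan, symmetric]
    by (rule prod.cong) (use that in \<open>auto simp: enhanced_entry_def matching_def indeterminate_def\<close>)
  have 0: "(\<Prod>i = 0..<n. enhanced_entry ends sides (ps ! i) (ts ! p i)) = 0"
    if "p permutes {0..<n}" "\<not> matching p" for p
    by (rule prod_zero) (use that in \<open>auto simp: enhanced_entry_def matching_def\<close>)
  have "Determinant.det (enhanced_matrix ends sides ps ts) =
      (\<Sum>p | p permutes {0..<n}. signof p * (\<Prod>i = 0..<n. enhanced_entry ends sides (ps ! i) (ts ! p i)))"
    unfolding M by (rule det_point_matrix)
  also have "\<dots> = (\<Sum>p | matching p. signof p * (\<Prod>i = 0..<n. enhanced_entry ends sides (ps ! i) (ts ! p i)))"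
    by (rule sum.mono_neutral_right[OF finite_permutations]) (auto simp: 0 matching_def)
  also have "\<dots> = (\<Sum>p | matching p. of_int (sign p) * Poly_Mapping.single (exponent p) 1)"
    by (rule sum.cong) (simp_all add: 1)
  finally show ?thesis .
qed

context
  fixes p assumes p: "matching p"
begin

lemma bij_matching: "bij_betw (\<lambda>i. ts ! p i) {0..<n} W\<^sub>0"
  using bij_betw_trans[OF permutes_imp_bij bij_ts] p by (simp add: matching_def comp_def)

lemma matched_subset: "matched c p \<subseteq> W\<^sub>0"
  using bij_betw_imp_surj_on[OF bij_matching] by (auto simp: matched_def)

lemma matched_disjoint: "c \<noteq> c' \<Longrightarrow> matched c p \<inter> matched c' p = {}"
  using bij_betw_imp_inj_on[OF bij_matching] by (auto simp: matched_def dest!: inj_onD)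

lemma matched_cover:
  assumes "t \<in> W\<^sub>0"
  shows "\<exists>c. t \<in> matched c p"
proof -
  obtain i where "i \<in> {0..<n}" "t = ts ! p i"
    using assms unfolding bij_betw_imp_surj_on[OF bij_matching, symmetric] by blast
  then have "t \<in> matched (colour_of (ps ! i)) p" by (auto simp: matched_def)
  then show ?thesis ..
qed

lemma matched_point:
  assumes "q \<notin> {RedPt r\<^sub>0, EmeraldPt e\<^sub>0, VioletPt v\<^sub>0}"
  obtains t where "t \<in> matched (colour_of q) p" "q \<in> corners ends sides t"
proof -
  have "q \<in> set ps" using assms by (simp add: set_ps)
  then obtain i where "i < n" "ps ! i = q" by (auto simp: in_set_conv_nth length_ps)
  then show thesis using p by (intro that[of "ts ! p i"]) (auto simp: matched_def matching_def)
qed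

lemma matched_unique:
  assumes "s \<in> matched (colour_of q) p" "t \<in> matched (colour_of q) p"
    "q \<in> corners ends sides s" "q \<in> corners ends sides t"
  shows "s = t"
proof -
  obtain i j where ij: "i < n" "j < n" "s = ts ! p i" "t = ts ! p j"
    "colour_of (ps ! i) = colour_of q" "colour_of (ps ! j) = colour_of q"
    using assms by (auto simp: matched_def)
  have "ps ! k = q" if "k < n" "colour_of (ps ! k) = colour_of q" "q \<in> corners ends sides (ts ! p k)" for k
    using p that by (cases q; cases "ps ! k") (auto simp: matching_def corners_eq)
  then have "ps ! i = ps ! j" using ij assms by metis
  then show ?thesis using ij distinct_ps by (simp add: nth_eq_iff_index_eq length_ps)
qed

lemma matched_nonroot:
  assumes "t \<in> matched c p" "q \<in> corners ends sides t" "colour_of q = c"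
  shows "q \<notin> {RedPt r\<^sub>0, EmeraldPt e\<^sub>0, VioletPt v\<^sub>0}"
proof -
  obtain i where i: "i < n" "t = ts ! p i" "colour_of (ps ! i) = c" using assms by (auto simp: matched_def)
  then have "ps ! i = q"
    using p assms by (cases q; cases "ps ! i") (auto simp: matching_def corners_eq)
  moreover have "ps ! i \<in> set ps" using i by (simp add: length_ps)
  ultimately show ?thesis by (simp add: set_ps)
qed

lemma transversal_matched: "transversal (matched Red p)"
  unfolding transversal_def
proof
  show "matched Red p \<subseteq> white ori" using matched_subset by auto
  have red: "RedPt r \<in> corners ends sides t \<longleftrightarrow> red_corner t = r" for r t by (auto simp: corners_eq)
  show "bij_betw red_corner (matched Red p) (UNIV - {r\<^sub>0})"
    unfolding bij_betw_def
  proof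
    show "inj_on red_corner (matched Red p)"
      using matched_unique[where q = "RedPt _"] by (intro inj_onI) (simp add: red)
    show "red_corner ` matched Red p = UNIV - {r\<^sub>0}"
    proof
      show "red_corner ` matched Red p \<subseteq> UNIV - {r\<^sub>0}"
        using matched_nonroot[where c = Red and q = "RedPt r\<^sub>0"] by (auto simp: red)
      show "UNIV - {r\<^sub>0} \<subseteq> red_corner ` matched Red p"
      proof
        fix r assume "r \<in> UNIV - {r\<^sub>0}"
        then obtain t where "t \<in> matched (colour_of (RedPt r)) p" "RedPt r \<in> corners ends sides t"
          using matched_point[of "RedPt r"] by auto
        then show "r \<in> red_corner ` matched Red p" by (auto simp: red)
      qed
    qed
  qed
qed

text \<open>A triangle at \<open>q\<close> that is not matched to a red point is matched to its
  corner of colour \<open>c\<close>, or to \<open>q\<close> itself, or it is the outer one. The last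
  two possibilities contribute one triangle \<open>s\<close> in total: the outer triangle if
  \<open>q\<close> is a root, the partner of \<open>q\<close> otherwise. This is the source of the
  \<open>+ 1\<close> in the degrees.\<close>

lemma star_matched:
  assumes q: "q \<in> {EmeraldPt e, VioletPt v}" and c: "c = (if colour_of q = Emerald then Violet else Emerald)"
  obtains s where "{t \<in> white ori - matched Red p. q \<in> corners ends sides t} = insert s {t \<in> matched c p. q \<in> corners ends sides t}"
    "s \<notin> matched c p"
proof -
  let ?A = "{t \<in> white ori - matched Red p. q \<in> corners ends sides t}"
  let ?B = "{t \<in> matched c p. q \<in> corners ends sides t}"
  define c' where "c' = colour_of q"
  have cc': "c' \<noteq> c" "c' \<noteq> Red" "c \<noteq> Red" "x = Red \<or> x = c \<or> x = c'" for x
    using q c by (auto simp: c'_def intro: colour.exhaust[of x])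
  have BA: "?B \<subseteq> ?A" using matched_subset[of c] matched_disjoint[OF cc'(3)] by auto
  have cover: "t = t\<^sub>0 \<or> t \<in> ?B \<or> t \<in> matched c' p" if "t \<in> ?A" for t
  proof (cases "t = t\<^sub>0")
    case False
    then obtain x where "t \<in> matched x p" using \<open>t \<in> ?A\<close> matched_cover[of t] by blast
    then show ?thesis using that cc'(4)[of x] by auto
  qed simp
  show thesis
  proof (cases "q \<in> corners ends sides t\<^sub>0")
    case True
    then have root: "q \<in> {RedPt r\<^sub>0, EmeraldPt e\<^sub>0, VioletPt v\<^sub>0}" by (simp add: root_corners)
    have "t \<notin> matched c' p" if "t \<in> ?A" for t
      using matched_nonroot[of t c' q] root that unfolding c'_def by blast
    then have "?A \<subseteq> insert t\<^sub>0 ?B" using cover by blast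
    moreover have "t\<^sub>0 \<in> ?A" "t\<^sub>0 \<notin> matched c p" using True root_white matched_subset by auto
    ultimately show thesis using BA by (intro that[of t\<^sub>0]) auto
  next
    case False
    then have "q \<notin> {RedPt r\<^sub>0, EmeraldPt e\<^sub>0, VioletPt v\<^sub>0}" by (simp add: root_corners)
    then obtain s where s: "s \<in> matched c' p" "q \<in> corners ends sides s"
      unfolding c'_def by (rule matched_point)
    have "t = s" if "t \<in> ?A" "t \<in> matched c' p" for t
      using matched_unique[of t q s] that s unfolding c'_def by blast
    then have "?A \<subseteq> insert s ?B" using cover False by blast
    moreover have "s \<in> ?A" "s \<notin> matched c p"
      using s matched_subset[of c'] matched_disjoint[OF cc'(2)] matched_disjoint[OF cc'(1)] by auto
    ultimately show thesis using BA by (intro that[of s]) auto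
  qed
qed

lemma lookup_exponent: "card {t \<in> white ori - matched Red p. em t = e} = Poly_Mapping.lookup (exponent p) e + 1"
proof -
  have em: "EmeraldPt e \<in> corners ends sides t \<longleftrightarrow> em t = e" for t by (auto simp: corners_eq)
  have "Poly_Mapping.lookup (exponent p) e = (\<Sum>i = 0..<n. of_bool (colour_of (ps ! i) = Violet \<and> em (ts ! p i) = e))"
    unfolding exponent_def lookup_sum by (rule sum.cong) (auto simp: lookup_single when_def)
  also have "\<dots> = card {i. i < n \<and> colour_of (ps ! i) = Violet \<and> em (ts ! p i) = e}"
    by (simp add: Int_def)
  also have "\<dots> = card ((\<lambda>i. ts ! p i) ` {i. i < n \<and> colour_of (ps ! i) = Violet \<and> em (ts ! p i) = e})"
    by (rule card_image[symmetric], rule inj_on_subset[OF bij_betw_imp_inj_on[OF bij_matching]]) auto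
  also have "(\<lambda>i. ts ! p i) ` {i. i < n \<and> colour_of (ps ! i) = Violet \<and> em (ts ! p i) = e} = {t \<in> matched Violet p. em t = e}"
    by (auto simp: matched_def)
  finally have "Poly_Mapping.lookup (exponent p) e = card {t \<in> matched Violet p. em t = e}" .
  moreover obtain s where "{t \<in> white ori - matched Red p. em t = e} = insert s {t \<in> matched Violet p. em t = e}"
    "s \<notin> matched Violet p"
    by (rule star_matched[of "EmeraldPt e" e undefined Violet]) (auto simp: em)
  ultimately show ?thesis by simp
qed

text \<open>Both values depend on \<open>p\<close> only through \<open>matched Red p\<close>, so two
  matchings with the same red part differ by a circulation on their emerald parts.\<close>

lemma circulation_matched:
  "(\<Sum>t\<in>{t\<in>white ori. em t = e}. of_bool (t \<in> matched Emerald p)) = (of_bool (e \<noteq> e\<^sub>0) :: real)"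
  "(\<Sum>t\<in>{t\<in>white ori. violet_corner t = v}. of_bool (t \<in> matched Emerald p)) =
    real (card {t \<in> white ori - matched Red p. violet_corner t = v}) - 1"
proof -
  have em: "EmeraldPt e \<in> corners ends sides t \<longleftrightarrow> em t = e" for e t by (auto simp: corners_eq)
  have vi: "VioletPt v \<in> corners ends sides t \<longleftrightarrow> violet_corner t = v" for v t by (auto simp: corners_eq)
  have sum: "(\<Sum>t\<in>{t\<in>white ori. P t}. of_bool (t \<in> matched Emerald p)) = real (card {t\<in>matched Emerald p. P t})" for P
  proof -
    have "{t\<in>white ori. P t} \<inter> {t. t \<in> matched Emerald p} = {t\<in>matched Emerald p. P t}"
      using matched_subset by auto
    then show ?thesis by simp
  qed
  show "(\<Sum>t\<in>{t\<in>white ori. em t = e}. of_bool (t \<in> matched Emerald p)) = (of_bool (e \<noteq> e\<^sub>0) :: real)"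
  proof (cases "e = e\<^sub>0")
    case True
    have "em t \<noteq> e" if "t \<in> matched Emerald p" for t
      using matched_nonroot[OF that, of "EmeraldPt e"] True by (auto simp: em)
    then have "{t\<in>matched Emerald p. em t = e} = {}" by blast
    then show ?thesis using True by (simp only: sum) simp
  next
    case False
    then obtain s where s: "s \<in> matched Emerald p" "em s = e"
      using matched_point[of "EmeraldPt e"] by (auto simp: em)
    have "t = s" if "t \<in> matched Emerald p" "em t = e" for t
      using matched_unique[of t "EmeraldPt e" s] that s by (simp add: em)
    with s have "{t\<in>matched Emerald p. em t = e} = {s}" by blast
    then show ?thesis using False by (simp only: sum) simp
  qed
  obtain s where "{t \<in> white ori - matched Red p. violet_corner t = v} = insert s {t \<in> matched Emerald p. violet_corner t = v}"
    "s \<notin> matched Emerald p"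
    by (rule star_matched[of "VioletPt v" undefined v Emerald]) (auto simp: vi)
  then show "(\<Sum>t\<in>{t\<in>white ori. violet_corner t = v}. of_bool (t \<in> matched Emerald p)) =
    real (card {t \<in> white ori - matched Red p. violet_corner t = v}) - 1"
    by (simp only: sum) simp
qed

end

text \<open>The difference of the emerald parts is a circulation that vanishes on the arborescence,
  hence everywhere. The violet part is what remains, and a triangle in the part of a given colour
  can only be matched to its corner of that colour.\<close>

lemma matching_unique:
  assumes p: "matching p" and q: "matching q" and eq: "matched Red p = matched Red q"
    and arb: "arborescence r\<^sub>0 (matched Red p)"
  shows "p = q"
proof -
  define c :: "'t \<Rightarrow> real" where "c t = of_bool (t \<in> matched Emerald p) - of_bool (t \<in> matched Emerald q)" for t
  have "circulation c"
    unfolding circulation_def c_def sum_subtractf circulation_matched[OF p] circulation_matched[OF q] eq by simp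
  moreover have "c t = 0" if "t \<in> matched Red p" for t
    using that matched_disjoint[OF p, of Red Emerald] matched_disjoint[OF q, of Red Emerald] eq
    by (auto simp: c_def)
  ultimately have "c t = 0" if "t \<in> white ori" for t
    using circulation_zero[OF arb] that by blast
  then have em: "matched Emerald p = matched Emerald q"
    using matched_subset[OF p, of Emerald] matched_subset[OF q, of Emerald]
    by (fastforce simp: c_def split: split_of_bool_asm)
  have rest: "matched Violet x = W\<^sub>0 - matched Red x - matched Emerald x" if x: "matching x" for x
  proof
    show "matched Violet x \<subseteq> W\<^sub>0 - matched Red x - matched Emerald x"
      using matched_subset[OF x, of Violet] matched_disjoint[OF x, of Violet Red]
        matched_disjoint[OF x, of Violet Emerald] by auto
    show "W\<^sub>0 - matched Red x - matched Emerald x \<subseteq> matched Violet x"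
    proof
      fix t assume t: "t \<in> W\<^sub>0 - matched Red x - matched Emerald x"
      then obtain c where "t \<in> matched c x" using matched_cover[OF x, of t] by blast
      with t show "t \<in> matched Violet x" by (cases c) auto
    qed
  qed
  have same: "matched c p = matched c q" for c
    by (cases c) (simp_all add: eq em rest[OF p] rest[OF q])
  have "p i = q i" for i
  proof (cases "i < n")
    case True
    have "ts ! p i \<in> matched (colour_of (ps ! i)) p" using True by (auto simp: matched_def)
    then have "ts ! p i \<in> matched (colour_of (ps ! i)) q" by (simp only: same)
    moreover have "ts ! q i \<in> matched (colour_of (ps ! i)) q" using True by (auto simp: matched_def)
    moreover have "ps ! i \<in> corners ends sides (ts ! p i)" "ps ! i \<in> corners ends sides (ts ! q i)"
      using p q True by (auto simp: matching_def)
    ultimately have "ts ! p i = ts ! q i" by (rule matched_unique[OF q])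
    moreover have "p i < n" "q i < n" using p q True permutes_in_image[of _ "{0..<n}" i] by (auto simp: matching_def)
    ultimately show ?thesis using distinct_ts by (simp add: nth_eq_iff_index_eq)
  next
    case False
    then show ?thesis using p q by (auto simp: matching_def permutes_def)
  qed
  then show ?thesis by blast
qed

section \<open>Coefficients of the determinant\<close>

definition sign_sum :: "'t set \<Rightarrow> int" where
  "sign_sum S = (\<Sum>p | matching p \<and> matched Red p = S. sign p)"

lemma transversal_subset_eq:
  assumes "transversal S" "transversal S'" "S \<subseteq> S'"
  shows "S = S'"
proof -
  have "card S = card S'"
    using assms(1,2) bij_betw_same_card unfolding transversal_def by metis
  then show ?thesis using assms(3) by (simp add: card_subset_eq)
qed

lemma det_sign_sum:
  assumes S: "transversal S"
  shows "Determinant.det (point_matrix (red_row 1 S 0 S')) = real_of_int (sign_sum S)"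
proof -
  have 1: "(\<Prod>i = 0..<n. red_row 1 S 0 S' (ps ! i) (ts ! p i)) = 1"
    if "matching p" "matched Red p = S" for p
    by (rule prod.neutral) (use that in \<open>auto simp: red_row_def matching_def matched_def\<close>)
  have 0: "(\<Prod>i = 0..<n. red_row 1 S 0 S' (ps ! i) (ts ! p i)) = 0"
    if p: "p permutes {0..<n}" "\<not> (matching p \<and> matched Red p = S)" for p
  proof (cases "matching p")
    case True
    \<comment> \<open>The red part of a matching is a transversal too, so it cannot be a proper
      subset of \<open>S\<close>.\<close>
    with p have "\<not> matched Red p \<subseteq> S" using transversal_subset_eq[OF transversal_matched S] by blast
    then obtain i where "i < n" "colour_of (ps ! i) = Red" "ts ! p i \<notin> S" by (auto simp: matched_def)
    then show ?thesis by (intro prod_zero bexI[of _ i]) (auto simp: red_row_def)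
  next
    case False
    then show ?thesis using p by (intro prod_zero) (auto simp: matching_def red_row_def)
  qed
  have "Determinant.det (point_matrix (red_row 1 S 0 S')) =
      (\<Sum>p | p permutes {0..<n}. signof p * (\<Prod>i = 0..<n. red_row 1 S 0 S' (ps ! i) (ts ! p i)))"
    by (rule det_point_matrix)
  also have "\<dots> = (\<Sum>p | matching p \<and> matched Red p = S. signof p * (\<Prod>i = 0..<n. red_row 1 S 0 S' (ps ! i) (ts ! p i)))"
    by (rule sum.mono_neutral_right[OF finite_permutations]) (auto simp: 0 matching_def)
  also have "\<dots> = (\<Sum>p | matching p \<and> matched Red p = S. signof p)"
    by (rule sum.cong) (auto simp: 1)
  finally show ?thesis by (simp add: sign_sum_def)
qed

lemma sign_sum_not_arborescence: "transversal S \<Longrightarrow> \<not> arborescence r\<^sub>0 S \<Longrightarrow> sign_sum S = 0"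
  using det_not_arborescence[of S S] det_sign_sum[of S S] by simp

text \<open>A matching exists because the determinant is nonzero, without being constructed; by
  uniqueness the sum is the sign of this single matching.\<close>

lemma sign_sum_arborescence:
  assumes S: "arborescence r\<^sub>0 S"
  shows "sign_sum S = 1 \<or> sign_sum S = - 1"
proof -
  have "real_of_int (sign_sum S) \<noteq> 0"
    using det_mixture_nonzero[OF S S, of 1 0] det_sign_sum[OF arborescence_transversal[OF S], of S] by simp
  then have "{p. matching p \<and> matched Red p = S} \<noteq> {}" by (metis sign_sum_def sum.empty of_int_0)
  then obtain p where p: "matching p" "matched Red p = S" by blast
  then have "{p. matching p \<and> matched Red p = S} = {p}" using matching_unique S by blast
  then have "sign_sum S = sign p" by (simp add: sign_sum_def)
  then show ?thesis by (simp add: sign_def)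
qed

lemma sign_sum_eq:
  assumes S: "arborescence r\<^sub>0 S" "arborescence r\<^sub>0 S'"
  shows "sign_sum S = sign_sum S'"
proof -
  have "red_row 0 S 1 S' = red_row 1 S' 0 S" by (simp add: red_row_def fun_eq_iff)
  then have "sgn (real_of_int (sign_sum S)) = sgn (real_of_int (sign_sum S'))"
    using det_same_sign[OF S] det_sign_sum S arborescence_transversal by metis
  then show ?thesis
    using sign_sum_arborescence[OF S(1)] sign_sum_arborescence[OF S(2)] by (elim disjE) simp_all
qed

definition has_degrees :: "'t set \<Rightarrow> ('e \<Rightarrow>\<^sub>0 nat) \<Rightarrow> bool" where
  "has_degrees S k \<longleftrightarrow> (\<forall>e. card {t \<in> white ori - S. em t = e} = Poly_Mapping.lookup k e + 1)"

lemma has_degrees_matched: "matching p \<Longrightarrow> has_degrees (matched Red p) k \<longleftrightarrow> exponent p = k"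
  by (simp only: has_degrees_def lookup_exponent poly_mapping_eq_iff fun_eq_iff add_right_cancel)

text \<open>The expansion terms are grouped by their red parts. Within the group of a transversal
  that is no arborescence they cancel.\<close>

lemma lookup_det:
  "Poly_Mapping.lookup (Determinant.det (enhanced_matrix ends sides ps ts)) k =
    (\<Sum>S | arborescence r\<^sub>0 S \<and> has_degrees S k. sign_sum S)"
proof -
  have "Poly_Mapping.lookup (Determinant.det (enhanced_matrix ends sides ps ts)) k =
      (\<Sum>p | matching p. if exponent p = k then sign p else 0)"
    by (simp add: det_enhanced_matrix lookup_sum lookup_of_int_single)
  also have "\<dots> = (\<Sum>p | matching p \<and> exponent p = k. sign p)"
    using sum.inter_filter[OF finite_matchings, of sign "\<lambda>p. exponent p = k"] by simp
  also have "\<dots> = (\<Sum>S | transversal S \<and> has_degrees S k. \<Sum>p\<in>{p \<in> {p. matching p \<and> exponent p = k}. matched Red p = S}. sign p)"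
  proof (rule sum.group[symmetric])
    show "finite {p. matching p \<and> exponent p = k}" by (rule finite_subset[OF _ finite_matchings]) auto
    show "matched Red ` {p. matching p \<and> exponent p = k} \<subseteq> {S. transversal S \<and> has_degrees S k}"
      using transversal_matched has_degrees_matched by auto
  qed simp
  also have "\<dots> = (\<Sum>S | transversal S \<and> has_degrees S k. sign_sum S)"
  proof (rule sum.cong)
    fix S assume "S \<in> {S. transversal S \<and> has_degrees S k}"
    then have "{p \<in> {p. matching p \<and> exponent p = k}. matched Red p = S} = {p. matching p \<and> matched Red p = S}"
      using has_degrees_matched by blast
    then show "(\<Sum>p\<in>{p \<in> {p. matching p \<and> exponent p = k}. matched Red p = S}. sign p) = sign_sum S"
      by (simp only: sign_sum_def)
  qed simp
  also have "\<dots> = (\<Sum>S | arborescence r\<^sub>0 S \<and> has_degrees S k. sign_sum S)"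
    by (rule sum.mono_neutral_right) (use arborescence_transversal sign_sum_not_arborescence in auto)
  finally show ?thesis .
qed

lemma hypertree_iff: "hypertree ends (Poly_Mapping.lookup k) \<longleftrightarrow> (\<exists>S. arborescence r\<^sub>0 S \<and> has_degrees S k)"
proof
  assume "hypertree ends (Poly_Mapping.lookup k)"
  then obtain x where "is_flow (real_vector_of (Poly_Mapping.lookup k)) x" by (rule hypertree_flow)
  then show "\<exists>S. arborescence r\<^sub>0 S \<and> has_degrees S k"
    unfolding has_degrees_def by (rule flow_hypertree)
next
  assume "\<exists>S. arborescence r\<^sub>0 S \<and> has_degrees S k"
  then show "hypertree ends (Poly_Mapping.lookup k)"
    unfolding has_degrees_def using arborescence_hypertree by blast
qed

lemma lookup_det_hypertree:
  assumes "arborescence r\<^sub>0 S"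
  shows "Poly_Mapping.lookup (Determinant.det (enhanced_matrix ends sides ps ts)) k =
    (if hypertree ends (Poly_Mapping.lookup k) then sign_sum S else 0)"
proof (cases "hypertree ends (Poly_Mapping.lookup k)")
  case True
  then obtain A where A: "arborescence r\<^sub>0 A" "has_degrees A k" by (auto simp: hypertree_iff)
  have "B = A" if B: "arborescence r\<^sub>0 B" "has_degrees B k" for B
    by (rule arborescence_unique[OF B(1) A(1)]) (use B(2) A(2) in \<open>simp only: has_degrees_def\<close>)
  with A have "{S. arborescence r\<^sub>0 S \<and> has_degrees S k} = {A}" by blast
  then show ?thesis using True sign_sum_eq[OF A(1) assms] by (simp add: lookup_det)
next
  case False
  then have "{S. arborescence r\<^sub>0 S \<and> has_degrees S k} = {}" by (auto simp: hypertree_iff)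
  then show ?thesis using False by (simp only: lookup_det sum.empty if_False)
qed

lemma keys_det:
  "Poly_Mapping.keys (Determinant.det (enhanced_matrix ends sides ps ts)) = {k. hypertree ends (Poly_Mapping.lookup k)}"
\<comment> \<open>Without an arborescence both sides are empty, so its existence need not be settled
  here.\<close>
proof (cases "\<exists>S. arborescence r\<^sub>0 S")
  case True
  then obtain S where S: "arborescence r\<^sub>0 S" by blast
  then have "sign_sum S \<noteq> 0" using sign_sum_arborescence by force
  then show ?thesis by (auto simp: in_keys_iff lookup_det_hypertree[OF S] split: if_splits)
next
  case False
  then have "{S. arborescence r\<^sub>0 S \<and> has_degrees S k} = {}" for k by blast
  then have "Poly_Mapping.lookup (Determinant.det (enhanced_matrix ends sides ps ts)) k = 0" for k
    by (simp only: lookup_det sum.empty)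
  then show ?thesis using False unfolding set_eq_iff mem_Collect_eq in_keys_iff hypertree_iff by blast
qed

lemma coefficients_det:
  "(\<forall>m \<in> Poly_Mapping.keys (Determinant.det (enhanced_matrix ends sides ps ts)).
      Poly_Mapping.lookup (Determinant.det (enhanced_matrix ends sides ps ts)) m = 1) \<or>
   (\<forall>m \<in> Poly_Mapping.keys (Determinant.det (enhanced_matrix ends sides ps ts)).
      Poly_Mapping.lookup (Determinant.det (enhanced_matrix ends sides ps ts)) m = - 1)"
proof (cases "\<exists>S. arborescence r\<^sub>0 S")
  case True
  then obtain S where S: "arborescence r\<^sub>0 S" by blast
  show ?thesis using sign_sum_arborescence[OF S] by (auto simp: keys_det lookup_det_hypertree[OF S])
next
  case False
  then show ?thesis by (auto simp: keys_det hypertree_iff)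
qed

lemma exponent_vectors_det:
  "Poly_Mapping.lookup ` Poly_Mapping.keys (Determinant.det (enhanced_matrix ends sides ps ts)) = {f. hypertree ends f}"
proof
  show "{f. hypertree ends f} \<subseteq> Poly_Mapping.lookup ` Poly_Mapping.keys (Determinant.det (enhanced_matrix ends sides ps ts))"
  proof
    fix f :: "'e \<Rightarrow> nat" assume "f \<in> {f. hypertree ends f}"
    then show "f \<in> Poly_Mapping.lookup ` Poly_Mapping.keys (Determinant.det (enhanced_matrix ends sides ps ts))"
      by (intro image_eqI[of _ _ "Abs_poly_mapping f"]) (simp_all add: keys_det)
  qed
qed (auto simp: keys_det)

end

theorem theorem10p5:
  fixes ends :: "'a::finite \<Rightarrow> ('r::finite, 'e::finite, 'v::finite) point set"
    and sides :: "'t::finite \<Rightarrow> 'a set"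
    and ori :: "'t \<Rightarrow> (('r, 'e, 'v) point \<times> ('r, 'e, 'v) point) set"
    and t\<^sub>0 :: 't and r\<^sub>0 :: 'r and e\<^sub>0 :: 'e and v\<^sub>0 :: 'v
    and ps :: "('r, 'e, 'v) point list" and ts :: "'t list"
  assumes "trinity ends sides ori"
    and "t\<^sub>0 \<in> white ori"
    and "corners ends sides t\<^sub>0 = {RedPt r\<^sub>0, EmeraldPt e\<^sub>0, VioletPt v\<^sub>0}"
    and "distinct ps" and "set ps = UNIV - {RedPt r\<^sub>0, EmeraldPt e\<^sub>0, VioletPt v\<^sub>0}"
    and "distinct ts" and "set ts = white ori - {t\<^sub>0}"
  shows "let D = Determinant.det (enhanced_matrix ends sides ps ts) in
      ((\<forall>m \<in> Poly_Mapping.keys D. Poly_Mapping.lookup D m = 1) \<or>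
       (\<forall>m \<in> Poly_Mapping.keys D. Poly_Mapping.lookup D m = - 1)) \<and>
      real_vector_of ` Poly_Mapping.lookup ` Poly_Mapping.keys D =
        hypertree_polytope ends \<inter> integer_vectors \<and>
      hypertree_polytope ends \<inter> integer_vectors = real_vector_of ` {f. hypertree ends f}"
proof -
  interpret trinity ends sides ori by (rule assms(1))
  interpret rooted_trinity ends sides ori t\<^sub>0 r\<^sub>0 e\<^sub>0 v\<^sub>0 ps ts
    by unfold_locales (use assms in auto)
  show ?thesis
    unfolding Let_def exponent_vectors_det hypertree_polytope_integer_points
    using coefficients_det by blast
qed

end
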